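(* Let $(W,S)$ be a Coxeter system with $W$ finite and longest element $w_S$. Let $I_\bullet=[I_0,\dots,I_m=J]$ be a reduced expression for a double coset $p$. Then there exists an expression $K_\bullet=[J=K_0,\dots,K_n]$ such that the concatenation $I_\bullet\circ K_\bullet=[I_0,\dots,I_m=K_0,\dots,K_n]$ is a reduced expression for the $(I_0,K_n)$-coset containing $w_S$. In fact, for $K'\subset S$, such a $K_\bullet$ with $K_n=K'$ exists if and only if $K'\subset K:=\mathrm{RD}(w_J\overline p^{-1}w_S)$.
   Context: Let $(W,S)$ be a Coxeter system with identity $e$, length $\ell_W$ and Bruhat order $\le$. For $w\in W$, $\mathrm{RD}(w)=\{s\in S:\ell_W(ws)<\ell_W(w)\}$ is the right descent set. For $I\subset S$ let $W_I$ be the parabolic subgroup generated by $I$; $I$ is finitary if $W_I$ is finite, and then $w_I$ is its longest element. For finitary $I,J$, a $(J,I)$-coset is a double coset $p\in W_J\backslash W/W_I$ (the pair $(J,I)$ is part of the data); it has a unique Bruhat-maximal element $\overline{p}$ and a unique Bruhat-minimal element $\underline{p}$. A (singular) expression is a sequence $[I_0,\dots,I_d]$ of finitary subsets of $S$, consecutive ones differing by adding or removing exactly one element of $S$. Its forward path is the sequence $p_0,\dots,p_d$ where $p_i$ is an $(I_0,I_i)$-coset, $e\in p_0$; if $I_i\subset I_{i+1}$, $p_{i+1}$ is the $(I_0,I_{i+1})$-coset containing $p_i$; if $I_i\supset I_{i+1}$, $p_{i+1}$ is the $(I_0,I_{i+1})$-coset containing $\overline{p_i}$. It is an expression for the double coset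 $p_d$. Put $K_i=I_0\cap\underline{p_i}I_i\underline{p_i}^{-1}$ (left redundancy). The expression is reduced if for every $i$ with $I_i\subset I_{i+1}$ the minimal elements $\underline{p_i},\underline{p_{i+1}}$ agree and the redundancies of $p_i$ and $p_{i+1}$ agree. *)

theory Defs
  imports "HOL-Algebra.Generated_Groups" "HOL-Algebra.Multiplicative_Group"
begin

section \<open>Coxeter systems\<close>

definition word_prod :: "('a, 'b) monoid_scheme \<Rightarrow> 'a list \<Rightarrow> 'a" where
  "word_prod G xs = foldr (\<lambda>x y. x \<otimes>\<^bsub>G\<^esub> y) xs \<one>\<^bsub>G\<^esub>"

text \<open>
  The congruence on words in \<open>S\<close> generated by the Coxeter relations \<open>(s t)^m(s,t) = 1\<close>, where
  \<open>m(s,t)\<close> is the order of \<open>s t\<close>. Since \<^const>\<open>group.ord\<close> is \<open>0\<close> on elements of infinite order, such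
  pairs contribute only the trivial relation. As the elements of \<open>S\<close> are involutions, the case
  \<open>s = t\<close> is the relation \<open>s s = 1\<close>; it makes every letter its own inverse, so words in \<open>S\<close>
  modulo this congruence form the group presented by these generators and relations.
\<close>

inductive coxeter_congruent :: "('a, 'b) monoid_scheme \<Rightarrow> 'a set \<Rightarrow> 'a list \<Rightarrow> 'a list \<Rightarrow> bool"
  for G :: "('a, 'b) monoid_scheme" and S :: "'a set" where
  refl: "set xs \<subseteq> S \<Longrightarrow> coxeter_congruent G S xs xs"
| sym: "coxeter_congruent G S xs ys \<Longrightarrow> coxeter_congruent G S ys xs"
| trans: "coxeter_congruent G S xs ys \<Longrightarrow> coxeter_congruent G S ys zs \<Longrightarrow> coxeter_congruent G S xs zs"
| relation: "s \<in> S \<Longrightarrow> t \<in> S \<Longrightarrow> set us \<subseteq> S \<Longrightarrow> set vs \<subseteq> S \<Longrightarrow>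
    coxeter_congruent G S
      (us @ concat (replicate (group.ord G (s \<otimes>\<^bsub>G\<^esub> t)) [s, t]) @ vs) (us @ vs)"

text \<open>
  The converse of the last axiom holds in every group, so that axiom says that the relations
  above present the group.
\<close>

locale coxeter_system = group G for G :: "('a, 'b) monoid_scheme" (structure) +
  fixes S :: "'a set"
  assumes generators_subset: "S \<subseteq> carrier G"
    and generates: "generate G S = carrier G"
    and involution: "s \<in> S \<Longrightarrow> s \<noteq> \<one> \<and> s \<otimes> s = \<one>"
    and presentation: "set xs \<subseteq> S \<Longrightarrow> set ys \<subseteq> S \<Longrightarrow>
      word_prod G xs = word_prod G ys \<Longrightarrow> coxeter_congruent G S xs ys"

definition cox_length :: "('a, 'b) monoid_scheme \<Rightarrow> 'a set \<Rightarrow> 'a \<Rightarrow> nat" where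
  "cox_length G S w = (LEAST n. \<exists>xs. set xs \<subseteq> S \<and> length xs = n \<and> word_prod G xs = w)"

definition reflections :: "('a, 'b) monoid_scheme \<Rightarrow> 'a set \<Rightarrow> 'a set" where
  "reflections G S = {g \<otimes>\<^bsub>G\<^esub> s \<otimes>\<^bsub>G\<^esub> inv\<^bsub>G\<^esub> g | g s. g \<in> carrier G \<and> s \<in> S}"

definition bruhat_le :: "('a, 'b) monoid_scheme \<Rightarrow> 'a set \<Rightarrow> 'a \<Rightarrow> 'a \<Rightarrow> bool" where
  "bruhat_le G S =
    (\<lambda>u v. \<exists>t \<in> reflections G S. v = u \<otimes>\<^bsub>G\<^esub> t \<and> cox_length G S u < cox_length G S v)\<^sup>*\<^sup>*"

definition right_descents :: "('a, 'b) monoid_scheme \<Rightarrow> 'a set \<Rightarrow> 'a \<Rightarrow> 'a set" where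
  "right_descents G S w = {s \<in> S. cox_length G S (w \<otimes>\<^bsub>G\<^esub> s) < cox_length G S w}"

definition finitary :: "('a, 'b) monoid_scheme \<Rightarrow> 'a set \<Rightarrow> 'a set \<Rightarrow> bool" where
  "finitary G S I \<longleftrightarrow> I \<subseteq> S \<and> finite (generate G I)"

text \<open>Meaningful for finitary \<open>I\<close>.\<close>

definition longest :: "('a, 'b) monoid_scheme \<Rightarrow> 'a set \<Rightarrow> 'a set \<Rightarrow> 'a" where
  "longest G S I = (THE w. w \<in> generate G I \<and>
    (\<forall>v \<in> generate G I. cox_length G S v \<le> cox_length G S w))"


section \<open>Double cosets\<close>

definition double_coset :: "('a, 'b) monoid_scheme \<Rightarrow> 'a set \<Rightarrow> 'a set \<Rightarrow> 'a \<Rightarrow> 'a set" where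
  "double_coset G J I x = (generate G J #>\<^bsub>G\<^esub> x) <#>\<^bsub>G\<^esub> generate G I"

definition double_cosets :: "('a, 'b) monoid_scheme \<Rightarrow> 'a set \<Rightarrow> 'a set \<Rightarrow> 'a set set" where
  "double_cosets G J I = double_coset G J I ` carrier G"

definition coset_max :: "('a, 'b) monoid_scheme \<Rightarrow> 'a set \<Rightarrow> 'a set \<Rightarrow> 'a" where
  "coset_max G S p = (THE x. x \<in> p \<and> (\<forall>y \<in> p. bruhat_le G S x y \<longrightarrow> y = x))"

definition coset_min :: "('a, 'b) monoid_scheme \<Rightarrow> 'a set \<Rightarrow> 'a set \<Rightarrow> 'a" where
  "coset_min G S p = (THE x. x \<in> p \<and> (\<forall>y \<in> p. bruhat_le G S y x \<longrightarrow> y = x))"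

definition left_redundancy :: "('a, 'b) monoid_scheme \<Rightarrow> 'a set \<Rightarrow> 'a set \<Rightarrow> 'a set \<Rightarrow> 'a set \<Rightarrow> 'a set" where
  "left_redundancy G S J I p =
    J \<inter> (\<lambda>s. coset_min G S p \<otimes>\<^bsub>G\<^esub> s \<otimes>\<^bsub>G\<^esub> inv\<^bsub>G\<^esub> (coset_min G S p)) ` I"


section \<open>Singular expressions\<close>

definition singular_expression :: "('a, 'b) monoid_scheme \<Rightarrow> 'a set \<Rightarrow> 'a set list \<Rightarrow> bool" where
  "singular_expression G S Is \<longleftrightarrow> Is \<noteq> [] \<and> (\<forall>I \<in> set Is. finitary G S I) \<and>
    (\<forall>i. Suc i < length Is \<longrightarrow>
      (\<exists>s \<in> S. s \<notin> Is ! i \<and> Is ! Suc i = insert s (Is ! i) \<or>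
               s \<in> Is ! i \<and> Is ! Suc i = Is ! i - {s}))"

definition forward_path ::
  "('a, 'b) monoid_scheme \<Rightarrow> 'a set \<Rightarrow> 'a set list \<Rightarrow> 'a set list \<Rightarrow> bool" where
  "forward_path G S Is ps \<longleftrightarrow> length ps = length Is \<and>
    (\<forall>i < length Is. ps ! i \<in> double_cosets G (hd Is) (Is ! i)) \<and>
    \<one>\<^bsub>G\<^esub> \<in> hd ps \<and>
    (\<forall>i. Suc i < length Is \<longrightarrow>
      (Is ! i \<subset> Is ! Suc i \<longrightarrow> ps ! i \<subseteq> ps ! Suc i) \<and>
      (Is ! Suc i \<subset> Is ! i \<longrightarrow> coset_max G S (ps ! i) \<in> ps ! Suc i))"

text \<open>
  A \<open>(J, I)\<close>-coset carries the pair \<open>(J, I)\<close> as part of its data, hence the arguments \<open>J\<close> and \<open>I\<close>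
  next to the underlying set \<open>p\<close>.
\<close>

definition reduced_expression_for ::
  "('a, 'b) monoid_scheme \<Rightarrow> 'a set \<Rightarrow> 'a set list \<Rightarrow> 'a set \<Rightarrow> 'a set \<Rightarrow> 'a set \<Rightarrow> bool" where
  "reduced_expression_for G S Is J I p \<longleftrightarrow>
    singular_expression G S Is \<and> hd Is = J \<and> last Is = I \<and>
    (\<exists>ps. forward_path G S Is ps \<and> last ps = p \<and>
      (\<forall>i. Suc i < length Is \<and> Is ! i \<subset> Is ! Suc i \<longrightarrow>
        coset_min G S (ps ! i) = coset_min G S (ps ! Suc i) \<and>
        left_redundancy G S J (Is ! i) (ps ! i) =
          left_redundancy G S J (Is ! Suc i) (ps ! Suc i)))"

text \<open>Used only when \<open>last Is = hd Ks\<close>.\<close>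

definition concat_expressions :: "'a set list \<Rightarrow> 'a set list \<Rightarrow> 'a set list" where
  "concat_expressions Is Ks = Is @ tl Ks"

end

theory Submission
  imports Defs
begin

text \<open>
  Write \<open>w\<^sub>I\<close> for the longest element of \<open>W\<^sub>I\<close> and \<open>LD\<close>, \<open>RD\<close> for left and right descent sets, and
  follow the maximal elements \<open>x\<close> of the cosets of a forward path. Shrinking \<open>I\<close> does not change
  \<open>x\<close>. Growing \<open>I\<close> to \<open>K\<close> is reduced exactly when \<open>x w\<^sub>I\<close>, which is shortest in its coset of \<open>W\<^sub>I\<close>,
  is still shortest in its coset of \<open>W\<^sub>K\<close>, and then \<open>x\<close> becomes \<open>x w\<^sub>I w\<^sub>K\<close> (\<open>reduced_growth_iff\<close>,
  \<open>growth_bi_maximal\<close>). Now pass to \<open>z = w\<^sub>I x\<^sup>-\<^sup>1 w\<^sub>S\<close>, which measures what \<open>x w\<^sub>I\<close> lacks to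
  reach \<open>w\<^sub>S\<close>, and which satisfies \<open>I \<subseteq> LD z\<close>. A reduced expression becomes a walk on pairs \<open>(I, z)\<close>
  that starts at \<open>(I\<^sub>0, w\<^sub>S)\<close> and has two kinds of steps: \<open>s\<close> may be added to \<open>I\<close> if \<open>s \<in> LD z\<close>, and
  \<open>z\<close> stays the same; or \<open>I\<close> shrinks to \<open>K\<close>, and \<open>z\<close> becomes \<open>w\<^sub>K w\<^sub>I z\<close>. These rules remember
  neither \<open>I\<^sub>0\<close> nor the path, so concatenating expressions is concatenating walks, and the
  expressions that complete the given one to the coset of \<open>w\<^sub>S\<close> are the walks from \<open>(J, z)\<close>, with
  \<open>z = w\<^sub>J x\<^sup>-\<^sup>1 w\<^sub>S\<close>, to \<open>(K', w\<^sub>K\<^sub>')\<close>.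

  If such a walk exists then \<open>K' \<subseteq> RD z\<close>: every step replaces \<open>z\<close> by the value of a suffix of one of
  its reduced words, so right descents can only disappear, and the final ones are \<open>RD w\<^sub>K\<^sub>' = K'\<close>.

  Conversely, \<open>J \<subseteq> LD z\<close> and \<open>K' \<subseteq> RD z\<close> together say that \<open>z\<close> is the maximal element of
  \<open>W\<^sub>J z W\<^sub>K\<^sub>'\<close>. Let \<open>m\<close> be the minimal one and \<open>L = J \<inter> m K' m\<^sup>-\<^sup>1\<close>. Then \<open>z = w\<^sub>J w\<^sub>L m w\<^sub>K\<^sub>'\<close>
  (\<open>bi_maximal_eq\<close>), so shrinking \<open>J\<close> to \<open>L\<close> turns \<open>z\<close> into \<open>m w\<^sub>K\<^sub>'\<close>. If \<open>m = 1\<close>, growing \<open>L\<close> to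
  \<open>K'\<close> finishes the walk. Otherwise take \<open>t \<in> LD m\<close> and grow \<open>L\<close> to \<open>L \<union> {t}\<close>. The new double coset
  contains \<open>t m\<close>, so its minimal element is shorter than \<open>m\<close>, and induction on the length of \<open>m\<close>
  applies.

  All of this needs the exchange condition, which is extracted from the presentation by counting
  modulo 2 how often the path of a word through the Cayley graph crosses each reflection.
\<close>

section \<open>Words and length\<close>

lemma (in group) inv_mult_cancel_left [simp]:
  "a \<in> carrier G \<Longrightarrow> b \<in> carrier G \<Longrightarrow> inv a \<otimes> (a \<otimes> b) = b"
  "a \<in> carrier G \<Longrightarrow> b \<in> carrier G \<Longrightarrow> a \<otimes> (inv a \<otimes> b) = b"
  by (simp_all flip: m_assoc)

lemma word_prod_simps [simp]:
  "word_prod G [] = \<one>\<^bsub>G\<^esub>"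
  "word_prod G (x # xs) = x \<otimes>\<^bsub>G\<^esub> word_prod G xs"
  by (simp_all add: word_prod_def)

context coxeter_system
begin

abbreviation len ("\<ell>") where "\<ell> \<equiv> cox_length G S"
abbreviation parabolic ("P") where "P \<equiv> generate G"
abbreviation wp where "wp \<equiv> word_prod G"

lemma S_carrier [simp, intro]: "s \<in> S \<Longrightarrow> s \<in> carrier G"
  using generators_subset by blast

lemma S_square [simp]: "s \<in> S \<Longrightarrow> s \<otimes> s = \<one>"
  using involution by blast

lemma S_inv [simp]: "s \<in> S \<Longrightarrow> inv s = s"
  by (simp add: inv_equality)

lemma S_square_left [simp]: "s \<in> S \<Longrightarrow> x \<in> carrier G \<Longrightarrow> s \<otimes> (s \<otimes> x) = x"
  by (simp flip: m_assoc)

lemma wp_closed [simp, intro]: "set xs \<subseteq> S \<Longrightarrow> wp xs \<in> carrier G"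
  by (induction xs) auto

lemma wp_append: "set xs \<subseteq> S \<Longrightarrow> set ys \<subseteq> S \<Longrightarrow> wp (xs @ ys) = wp xs \<otimes> wp ys"
  by (induction xs) (auto simp: m_assoc)

lemma wp_rev: "set xs \<subseteq> S \<Longrightarrow> wp (rev xs) = inv (wp xs)"
  by (induction xs) (auto simp: wp_append inv_mult_group)

lemma wp_in_parabolic: "set xs \<subseteq> I \<Longrightarrow> wp xs \<in> P I"
  by (induction xs) (auto intro: generate.one generate.eng generate.incl)

lemma parabolic_word:
  assumes "I \<subseteq> S" "w \<in> P I"
  obtains xs where "set xs \<subseteq> I" "wp xs = w"
proof -
  from assms(2) have "\<exists>xs. set xs \<subseteq> I \<and> wp xs = w"
  proof (induction rule: generate.induct)
    case one
    show ?case by (intro exI[of _ "[]"]) simp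
  next
    case (incl h)
    then show ?case using assms(1) by (intro exI[of _ "[h]"]) auto
  next
    case (inv h)
    then have "h \<in> S" using assms(1) by blast
    with inv show ?case by (intro exI[of _ "[h]"]) auto
  next
    case (eng h1 h2)
    then obtain xs ys where "set xs \<subseteq> I" "wp xs = h1" "set ys \<subseteq> I" "wp ys = h2" by blast
    then show ?case using assms(1)
      by (intro exI[of _ "xs @ ys"]) (simp add: wp_append subset_trans[of _ I S])
  qed
  then show thesis using that by blast
qed

lemma parabolic_carrier: "I \<subseteq> S \<Longrightarrow> w \<in> P I \<Longrightarrow> w \<in> carrier G"
  using generate_in_carrier generators_subset by blast

lemma parabolic_subgroup: "I \<subseteq> S \<Longrightarrow> subgroup (P I) G"
  using generate_is_subgroup generators_subset by blast

lemma parabolic_inv: "I \<subseteq> S \<Longrightarrow> u \<in> P I \<Longrightarrow> inv u \<in> P I"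
  by (rule subgroup.m_inv_closed[OF parabolic_subgroup])

lemma len_le: "set xs \<subseteq> S \<Longrightarrow> \<ell> (wp xs) \<le> length xs"
  unfolding cox_length_def by (rule Least_le) blast

lemma reduced_word:
  assumes "w \<in> carrier G"
  obtains xs where "set xs \<subseteq> S" "wp xs = w" "length xs = \<ell> w"
proof -
  obtain ys where "set ys \<subseteq> S" "wp ys = w"
    using assms generates parabolic_word[of S w] by auto
  then have "\<exists>n xs. set xs \<subseteq> S \<and> length xs = n \<and> wp xs = w" by blast
  from LeastI_ex[OF this] have "\<exists>xs. set xs \<subseteq> S \<and> length xs = \<ell> w \<and> wp xs = w"
    unfolding cox_length_def .
  then show thesis using that by metis
qed

lemma len_one [simp]: "\<ell> \<one> = 0"
  using len_le[of "[]"] by simp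

lemma len_eq_0: "w \<in> carrier G \<Longrightarrow> \<ell> w = 0 \<longleftrightarrow> w = \<one>"
  by (metis reduced_word length_0_conv word_prod_simps(1) len_one)

lemma len_mult_le:
  assumes "u \<in> carrier G" "v \<in> carrier G" shows "\<ell> (u \<otimes> v) \<le> \<ell> u + \<ell> v"
proof -
  obtain xs where xs: "set xs \<subseteq> S" "wp xs = u" "length xs = \<ell> u" using assms(1) reduced_word by blast
  obtain ys where ys: "set ys \<subseteq> S" "wp ys = v" "length ys = \<ell> v" using assms(2) reduced_word by blast
  show ?thesis using xs ys len_le[of "xs @ ys"] wp_append[of xs ys] by simp
qed

lemma len_inv [simp]:
  assumes "w \<in> carrier G" shows "\<ell> (inv w) = \<ell> w"
proof -
  have "\<ell> (inv u) \<le> \<ell> u" if u: "u \<in> carrier G" for u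
  proof -
    obtain xs where xs: "set xs \<subseteq> S" "wp xs = u" "length xs = \<ell> u" using u reduced_word by blast
    then show ?thesis using len_le[of "rev xs"] wp_rev[of xs] by simp
  qed
  from this[of w] this[of "inv w"] assms show ?thesis by simp
qed

lemma len_generator [simp]: "s \<in> S \<Longrightarrow> \<ell> s = 1"
  using len_le[of "[s]"] len_eq_0[of s] involution[of s] by (cases "\<ell> s") auto

section \<open>The exchange condition\<close>

text \<open>
  The prefixes of a word \<open>s\<^sub>1 \<dots> s\<^sub>k\<close> trace a path in the Cayley graph that successively crosses the
  reflections \<open>s\<^sub>1 \<dots> s\<^sub>i\<^sub>-\<^sub>1 s\<^sub>i s\<^sub>i\<^sub>-\<^sub>1 \<dots> s\<^sub>1\<close>. The number of times that it crosses \<open>t\<close> is computed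
  letter by letter, where passing a letter \<open>x\<close> conjugates the target by \<open>x\<close>.
\<close>

fun crossings where
  "crossings [] t = (0::nat)"
| "crossings (x # xs) t = (if t = x then 1 else 0) + crossings xs (x \<otimes> t \<otimes> x)"

lemma crossings_append:
  "set us \<subseteq> S \<Longrightarrow> t \<in> carrier G \<Longrightarrow>
    crossings (us @ vs) t = crossings us t + crossings vs (inv (wp us) \<otimes> t \<otimes> wp us)"
  by (induction us arbitrary: t) (auto simp: inv_mult_group m_assoc)

text \<open>
  With \<open>a = s t\<close>, the successive reflections crossed by \<open>s t s t \<dots>\<close> are \<open>s\<close>, \<open>a s\<close>, \<open>a\<^sup>2 s\<close>, and so on.
\<close>

lemma crossings_alternating:
  assumes s: "s \<in> S" and t: "t \<in> S" and r: "r \<in> carrier G"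
  shows "crossings (concat (replicate k [s, t])) r =
    (\<Sum>i<2 * k. if r = (s \<otimes> t) [^] i \<otimes> s then 1 else 0)"
  using r
proof (induction k arbitrary: r)
  case 0
  then show ?case by simp
next
  case (Suc k)
  let ?a = "s \<otimes> t"
  have a: "?a \<in> carrier G" using s t by auto
  let ?r = "t \<otimes> (s \<otimes> r \<otimes> s) \<otimes> t"
  have r': "?r \<in> carrier G" using s t Suc.prems by auto
  have conj_r: "?r = inv ?a \<otimes> r \<otimes> ?a"
    using s t Suc.prems by (simp add: inv_mult_group m_assoc)
  have shift: "?r = ?a [^] i \<otimes> s \<longleftrightarrow> r = ?a [^] Suc (Suc i) \<otimes> s" for i :: nat
  proof -
    have p: "?a [^] i \<in> carrier G" using a by simp
    have "?a [^] Suc (Suc i) \<otimes> s = ?a \<otimes> (?a [^] i \<otimes> s) \<otimes> inv ?a"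
    proof -
      have "?a [^] Suc (Suc i) = ?a \<otimes> ?a [^] i \<otimes> ?a"
        using a by (metis nat_pow_Suc nat_pow_Suc2)
      moreover have "?a \<otimes> s = s \<otimes> inv ?a"
        using s t by (simp add: inv_mult_group m_assoc)
      ultimately show ?thesis using s a p by (simp add: m_assoc)
    qed
    moreover have "r = ?a \<otimes> ?r \<otimes> inv ?a"
      unfolding conj_r using a Suc.prems by (simp add: m_assoc)
    moreover have "?r = c \<longleftrightarrow> ?a \<otimes> ?r \<otimes> inv ?a = ?a \<otimes> c \<otimes> inv ?a" if "c \<in> carrier G" for c
      using a r' that by simp
    ultimately show ?thesis using p s by simp
  qed
  have first: "s \<otimes> r \<otimes> s = t \<longleftrightarrow> r = ?a \<otimes> s"
    using s t Suc.prems by (metis S_carrier S_square S_square_left m_assoc r_one m_closed)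
  have "crossings (concat (replicate (Suc k) [s, t])) r =
      (if r = s then 1 else 0) + (if r = ?a \<otimes> s then 1 else 0) +
      (\<Sum>i<2 * k. if r = ?a [^] Suc (Suc i) \<otimes> s then 1 else 0)"
    using first by (simp add: Suc.IH[OF r'] shift)
  also have "\<dots> = (\<Sum>i<Suc (Suc (2 * k)). if r = ?a [^] i \<otimes> s then 1 else 0)"
    using s a by (simp only: sum.lessThan_Suc_shift) simp
  finally show ?case by simp
qed

text \<open>
  As \<open>a\<^sup>m = 1\<close>, the sequence \<open>a\<^sup>i s\<close> for \<open>i < 2 m\<close> runs twice through the same list.
\<close>

lemma crossings_relation_even:
  assumes s: "s \<in> S" and t: "t \<in> S" and r: "r \<in> carrier G"
  shows "even (crossings (concat (replicate (group.ord G (s \<otimes> t)) [s, t])) r)"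
proof -
  let ?a = "s \<otimes> t" and ?m = "group.ord G (s \<otimes> t)"
  let ?f = "\<lambda>i. if r = ?a [^] i \<otimes> s then 1 else (0::nat)"
  have a: "?a \<in> carrier G" using s t by auto
  have am: "?a [^] ?m = \<one>" using a by simp
  have "(\<Sum>i<?m + n. ?f i) = (\<Sum>i<?m. ?f i) + (\<Sum>i<n. ?f (?m + i))" for n
    by (induction n) auto
  then have "(\<Sum>i<?m + ?m. ?f i) = (\<Sum>i<?m. ?f i) + (\<Sum>i<?m. ?f (?m + i))" .
  also have "\<dots> = 2 * (\<Sum>i<?m. ?f i)"
    using a by (simp only: am l_one S_carrier nat_pow_closed mult_2 flip: nat_pow_mult)
  finally show ?thesis
    unfolding crossings_alternating[OF s t r] by (simp add: mult_2)
qed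

text \<open>
  Parities, unlike the numbers of crossings themselves, survive the insertion of a relation:
  \<open>(s t)\<^sup>m\<close> has even length and crosses every reflection an even number of times, and its value
  \<open>1\<close> leaves the reflections crossed afterwards in place.
\<close>

lemma congruent_invariants:
  assumes "coxeter_congruent G S xs ys"
  shows "set xs \<subseteq> S \<and> set ys \<subseteq> S \<and> wp xs = wp ys \<and>
    (even (length xs) \<longleftrightarrow> even (length ys)) \<and>
    (\<forall>t \<in> carrier G. even (crossings xs t) \<longleftrightarrow> even (crossings ys t))"
  using assms
proof (induction rule: coxeter_congruent.induct)
  case (relation s t us vs)
  let ?m = "group.ord G (s \<otimes> t)"
  let ?c = "concat (replicate ?m [s, t])"
  have c: "set ?c \<subseteq> S" using relation by auto
  have pow: "wp (concat (replicate k [s, t])) = (s \<otimes> t) [^] k" for k :: nat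
  proof (induction k)
    case (Suc k)
    have "(s \<otimes> t) [^] Suc k = (s \<otimes> t) \<otimes> (s \<otimes> t) [^] k"
      using relation nat_pow_Suc2[of "s \<otimes> t" k] by auto
    with Suc show ?case using relation by (simp add: m_assoc)
  qed simp
  have c1: "wp ?c = \<one>" unfolding pow using relation by auto
  have len: "even (length ?c)"
    by (simp add: length_concat sum_list_replicate)
  have "wp (us @ ?c @ vs) = wp (us @ vs)"
    using relation c c1 by (simp add: wp_append)
  moreover have "even (crossings (us @ ?c @ vs) r) \<longleftrightarrow> even (crossings (us @ vs) r)"
    if r: "r \<in> carrier G" for r
  proof -
    let ?r = "inv (wp us) \<otimes> r \<otimes> wp us"
    have r': "?r \<in> carrier G" using r relation by auto
    have "crossings (us @ ?c @ vs) r = crossings us r + (crossings ?c ?r + crossings vs ?r)"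
      using r r' relation c c1 by (simp add: crossings_append)
    moreover have "crossings (us @ vs) r = crossings us r + crossings vs ?r"
      using r relation by (simp add: crossings_append)
    ultimately show ?thesis using crossings_relation_even[of s t ?r] relation r' by simp
  qed
  ultimately show ?case using relation c len by auto
qed auto

lemma even_len:
  assumes "set xs \<subseteq> S" shows "even (\<ell> (wp xs)) \<longleftrightarrow> even (length xs)"
proof -
  obtain ys where "set ys \<subseteq> S" "wp ys = wp xs" "length ys = \<ell> (wp xs)"
    using assms reduced_word[of "wp xs"] by blast
  then show ?thesis using congruent_invariants[of ys xs] presentation[of ys xs] assms by auto
qed

text \<open>
  Two words for one element have lengths of the same parity, so multiplying by a generator cannot
  preserve the length.
\<close>

lemma len_step:
  assumes "s \<in> S" "w \<in> carrier G"
  shows "\<ell> (s \<otimes> w) = Suc (\<ell> w) \<or> \<ell> w = Suc (\<ell> (s \<otimes> w))"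
proof -
  obtain xs where xs: "set xs \<subseteq> S" "wp xs = w" "length xs = \<ell> w"
    using assms reduced_word by blast
  have "even (\<ell> (s \<otimes> w)) \<noteq> even (\<ell> w)"
    using xs assms(1) even_len[of "s # xs"] by auto
  moreover have "\<ell> (s \<otimes> w) \<le> Suc (\<ell> w)" using len_mult_le[of s w] assms by simp
  moreover have "\<ell> w \<le> Suc (\<ell> (s \<otimes> w))" using len_mult_le[of s "s \<otimes> w"] assms by simp
  ultimately show ?thesis by (metis le_SucE le_antisym)
qed

lemma len_step_right:
  assumes "s \<in> S" "w \<in> carrier G"
  shows "\<ell> (w \<otimes> s) = Suc (\<ell> w) \<or> \<ell> w = Suc (\<ell> (w \<otimes> s))"
  using len_step[of s "inv w"] len_inv[of "w \<otimes> s"] assms by (simp add: inv_mult_group)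

text \<open>
  If the \<open>i\<close>-th reflection crossed is \<open>t = u s\<^sub>i u\<^sup>-\<^sup>1\<close> with \<open>u = s\<^sub>1 \<dots> s\<^sub>i\<^sub>-\<^sub>1\<close>, then multiplying by \<open>t\<close>
  on the left cancels that occurrence of \<open>s\<^sub>i\<close>.
\<close>

lemma crossing_deletion:
  assumes "set xs \<subseteq> S" "t \<in> carrier G" "crossings xs t > 0"
  shows "\<exists>us x vs. xs = us @ x # vs \<and> t \<otimes> wp xs = wp (us @ vs)"
  using assms
proof (induction xs arbitrary: t)
  case (Cons x xs)
  show ?case
  proof (cases "t = x")
    case True
    then show ?thesis using Cons.prems by (intro exI[of _ "[]"] exI[of _ x] exI[of _ xs]) simp
  next
    case False
    then obtain us y vs where d: "xs = us @ y # vs" "x \<otimes> t \<otimes> x \<otimes> wp xs = wp (us @ vs)"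
      using Cons.IH[of "x \<otimes> t \<otimes> x"] Cons.prems by auto
    have "t \<otimes> wp (x # xs) = x \<otimes> (x \<otimes> t \<otimes> x \<otimes> wp xs)"
      using Cons.prems by (simp add: m_assoc)
    with d show ?thesis
      by (intro exI[of _ "x # us"] exI[of _ y] exI[of _ vs]) simp
  qed
qed simp

text \<open>
  Let \<open>ys\<close> be a reduced word of \<open>s w\<close>. It cannot cross \<open>s\<close>, since deleting a letter would give a
  word for \<open>w\<close> that is too short. So \<open>s # ys\<close>, which is a word for \<open>w\<close>, crosses \<open>s\<close> exactly once,
  and by the invariance of parities every word for \<open>w\<close> crosses \<open>s\<close>.
\<close>

lemma exchange:
  assumes xs: "set xs \<subseteq> S" and s: "s \<in> S" and less: "\<ell> (s \<otimes> wp xs) < \<ell> (wp xs)"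
  shows "\<exists>us x vs. xs = us @ x # vs \<and> s \<otimes> wp xs = wp (us @ vs)"
proof -
  let ?w = "wp xs"
  have w: "?w \<in> carrier G" using xs by auto
  obtain ys where ys: "set ys \<subseteq> S" "wp ys = s \<otimes> ?w" "length ys = \<ell> (s \<otimes> ?w)"
    using reduced_word[of "s \<otimes> ?w"] s w by auto
  have "crossings ys s = 0"
  proof (rule ccontr)
    assume "crossings ys s \<noteq> 0"
    then obtain us x vs where "ys = us @ x # vs" "s \<otimes> wp ys = wp (us @ vs)"
      using crossing_deletion[of ys s] ys s by auto
    then have "\<ell> ?w < length ys" using ys s w len_le[of "us @ vs"] by auto
    with ys less show False by simp
  qed
  \<comment> \<open>The first letter crosses \<open>s\<close>, and the rest crosses \<open>s s s = s\<close> zero times.\<close>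
  then have "odd (crossings (s # ys) s)" using s by simp
  moreover have "coxeter_congruent G S (s # ys) xs"
    using presentation[of "s # ys" xs] xs ys s w by simp
  ultimately have "odd (crossings xs s)" using congruent_invariants s by blast
  then show ?thesis using crossing_deletion[of xs s] xs s by (metis S_carrier odd_pos)
qed

text \<open>
  Exchange in the concatenation of reduced words of \<open>u\<close> and \<open>v\<close>: the deleted letter lies in one of
  the two.
\<close>

lemma exchange_mult:
  assumes s: "s \<in> S" and u: "u \<in> carrier G" and v: "v \<in> carrier G"
    and less: "\<ell> (s \<otimes> u \<otimes> v) < \<ell> (u \<otimes> v)"
  shows "\<ell> (s \<otimes> u) < \<ell> u \<or> \<ell> (inv u \<otimes> s \<otimes> u \<otimes> v) < \<ell> v"
proof -
  obtain xs where xs: "set xs \<subseteq> S" "wp xs = u" "length xs = \<ell> u" using u reduced_word by blast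
  obtain ys where ys: "set ys \<subseteq> S" "wp ys = v" "length ys = \<ell> v" using v reduced_word by blast
  obtain us x vs where d: "xs @ ys = us @ x # vs" "s \<otimes> wp (xs @ ys) = wp (us @ vs)"
    using exchange[of "xs @ ys" s] s xs ys less wp_append[of xs ys] u v
    by (metis S_carrier le_sup_iff m_assoc set_append)
  have eq: "s \<otimes> u \<otimes> v = wp (us @ vs)"
    using d(2) xs ys u v s by (simp add: wp_append[of xs ys] m_assoc)
  consider zs where "xs = us @ x # zs" "vs = zs @ ys"
    | zs where "us = xs @ zs" "ys = zs @ x # vs"
    using d(1) by (auto simp: append_eq_append_conv2 Cons_eq_append_conv append_eq_Cons_conv)
  then show ?thesis
  proof cases
    case 1
    then have "s \<otimes> u \<otimes> v = wp (us @ zs) \<otimes> v" using eq xs ys wp_append[of "us @ zs" ys] by simp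
    then have "s \<otimes> u = wp (us @ zs)" using s u v xs 1 by auto
    then show ?thesis using 1 xs len_le[of "us @ zs"] by auto
  next
    case 2
    then have "s \<otimes> u \<otimes> v = u \<otimes> wp (zs @ vs)" using eq xs ys wp_append[of xs "zs @ vs"] by simp
    then have "inv u \<otimes> s \<otimes> u \<otimes> v = wp (zs @ vs)"
      using s u v ys 2 by (simp add: m_assoc)
    then show ?thesis using 2 ys len_le[of "zs @ vs"] by auto
  qed
qed

section \<open>Parabolic subgroups\<close>

text \<open>
  Exchange only deletes letters, so shortening a word never leaves the alphabet \<open>I\<close>.
\<close>

lemma parabolic_reduced_word:
  assumes I: "I \<subseteq> S" and w: "w \<in> P I"
  obtains xs where "set xs \<subseteq> I" "wp xs = w" "length xs = \<ell> w"
proof -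
  have "\<exists>ys. set ys \<subseteq> I \<and> wp ys = wp xs \<and> length ys = \<ell> (wp xs)" if "set xs \<subseteq> I" for xs
    using that
  proof (induction xs)
    case Nil
    then show ?case by (intro exI[of _ "[]"]) simp
  next
    case (Cons x xs)
    then obtain ys where ys: "set ys \<subseteq> I" "wp ys = wp xs" "length ys = \<ell> (wp xs)" by auto
    have x: "x \<in> S" and xs: "wp xs \<in> carrier G" using Cons.prems I by auto
    show ?case
    proof (cases "\<ell> (x \<otimes> wp xs) < \<ell> (wp xs)")
      case True
      then obtain us y vs where d: "ys = us @ y # vs" "x \<otimes> wp ys = wp (us @ vs)"
        using exchange[of ys x] ys I x by (metis subset_trans)
      then show ?thesis using ys len_step[OF x xs] True
        by (intro exI[of _ "us @ vs"]) auto
    next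
      case False
      then show ?thesis using ys len_step[OF x xs] Cons.prems
        by (intro exI[of _ "x # ys"]) auto
    qed
  qed
  then show thesis using that parabolic_word[OF I w] by metis
qed

lemma parabolic_induct [consumes 2, case_names one step]:
  assumes "I \<subseteq> S" "w \<in> P I" and one: "Q \<one>"
    and step: "\<And>s u. s \<in> I \<Longrightarrow> u \<in> P I \<Longrightarrow> \<ell> (s \<otimes> u) = Suc (\<ell> u) \<Longrightarrow> Q u \<Longrightarrow> Q (s \<otimes> u)"
  shows "Q w"
proof -
  have "Q (wp xs)" if "set xs \<subseteq> I" "length xs = \<ell> (wp xs)" for xs
    using that
  proof (induction xs)
    case (Cons x xs)
    then have x: "x \<in> S" "set xs \<subseteq> S" using assms(1) by auto
    have "\<ell> (x \<otimes> wp xs) \<le> Suc (\<ell> (wp xs))" using len_step x by (metis Suc_n_not_le_n le_SucI nat_le_linear wp_closed)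
    then have "length xs = \<ell> (wp xs)" using Cons.prems len_le[of xs] x by auto
    then show ?case using Cons x wp_in_parabolic[of xs I] by (auto intro!: step)
  qed (simp add: one)
  then show ?thesis using parabolic_reduced_word[OF assms(1,2)] by metis
qed

lemma generator_in_parabolic:
  assumes "I \<subseteq> S" "s \<in> S" "s \<in> P I" shows "s \<in> I"
proof -
  obtain xs where "set xs \<subseteq> I" "wp xs = s" "length xs = 1"
    using parabolic_reduced_word[OF assms(1,3)] assms(2) by auto
  then show ?thesis using assms(1) by (auto simp: length_Suc_conv)
qed

definition left_descents where "left_descents w = {s \<in> S. \<ell> (s \<otimes> w) < \<ell> w}"

abbreviation RD where "RD \<equiv> right_descents G S"
abbreviation LD where "LD \<equiv> left_descents"

lemma right_descents_inv: "w \<in> carrier G \<Longrightarrow> RD (inv w) = LD w"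
  using len_inv[of "_ \<otimes> w"] by (auto simp: left_descents_def right_descents_def inv_mult_group)
    (metis S_carrier S_inv inv_mult_group len_inv m_closed)+

lemma left_descents_inv: "w \<in> carrier G \<Longrightarrow> LD (inv w) = RD w"
  using right_descents_inv[of "inv w"] by simp

text \<open>
  A reduced word of \<open>x\<close> can be made to start with any given \<open>v \<in> W\<^sub>J\<close>, one letter of \<open>v\<close> at a time:
  if \<open>x = u y\<close> with lengths adding up and \<open>s u\<close> is longer than \<open>u\<close>, then exchanging \<open>s \<in> J \<subseteq> LD x\<close>
  cannot delete in \<open>u\<close>, so it deletes in \<open>y\<close> and \<open>x\<close> starts with \<open>s u\<close>.
\<close>

lemma len_left_max:
  assumes J: "J \<subseteq> S" and x: "x \<in> carrier G" and max: "J \<subseteq> LD x" and u: "u \<in> P J"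
  shows "\<ell> (u \<otimes> x) + \<ell> u = \<ell> x"
proof -
  have "\<ell> (inv v \<otimes> x) + \<ell> v = \<ell> x" if "v \<in> P J" for v
    using J that
  proof (induction v rule: parabolic_induct)
    case one
    then show ?case using x by simp
  next
    case (step s u)
    have s: "s \<in> S" and u: "u \<in> carrier G" using step J parabolic_carrier by auto
    let ?v = "inv u \<otimes> x"
    have v: "?v \<in> carrier G" using u x by simp
    have "\<ell> (s \<otimes> u \<otimes> ?v) < \<ell> (u \<otimes> ?v)"
      using step(1) max s u x by (auto simp: left_descents_def m_assoc)
    then have "\<ell> (inv u \<otimes> s \<otimes> u \<otimes> ?v) < \<ell> ?v"
      using exchange_mult[OF s u v] step(3) by auto
    moreover have "inv u \<otimes> s \<otimes> u \<otimes> ?v = inv (s \<otimes> u) \<otimes> x"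
      using s u x by (simp add: inv_mult_group m_assoc)
    moreover have "\<ell> x \<le> \<ell> (s \<otimes> u) + \<ell> (inv (s \<otimes> u) \<otimes> x)"
      using len_mult_le[of "s \<otimes> u" "inv (s \<otimes> u) \<otimes> x"] s u x by simp
    ultimately show ?case using step by simp
  qed
  from this[OF parabolic_inv[OF J u]] show ?thesis using parabolic_carrier[OF J u] by simp
qed

lemma left_descents_subset: "LD w \<subseteq> S"
  by (auto simp: left_descents_def)

lemma not_left_descent: "s \<in> S \<Longrightarrow> w \<in> carrier G \<Longrightarrow> s \<notin> LD w \<longleftrightarrow> \<ell> (s \<otimes> w) = Suc (\<ell> w)"
  using len_step[of s w] by (auto simp: left_descents_def)

lemma not_right_descent: "s \<in> S \<Longrightarrow> w \<in> carrier G \<Longrightarrow> s \<notin> RD w \<longleftrightarrow> \<ell> (w \<otimes> s) = Suc (\<ell> w)"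
  using len_step_right[of s w] by (auto simp: right_descents_def)

lemma right_descents_mult:
  assumes "u \<in> carrier G" "v \<in> carrier G" "\<ell> (u \<otimes> v) = \<ell> u + \<ell> v"
  shows "RD v \<subseteq> RD (u \<otimes> v)"
proof
  fix s assume "s \<in> RD v"
  then have s: "s \<in> S" "\<ell> (v \<otimes> s) < \<ell> v" by (auto simp: right_descents_def)
  then have "\<ell> (u \<otimes> v \<otimes> s) < \<ell> (u \<otimes> v)"
    using len_mult_le[of u "v \<otimes> s"] assms by (simp add: m_assoc)
  with s show "s \<in> RD (u \<otimes> v)" by (simp add: right_descents_def)
qed

lemma left_descents_mult:
  assumes "u \<in> carrier G" "v \<in> carrier G" "\<ell> (u \<otimes> v) = \<ell> u + \<ell> v"
  shows "LD u \<subseteq> LD (u \<otimes> v)"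
  using right_descents_mult[of "inv v" "inv u"] assms len_inv[of "u \<otimes> v"]
  by (simp add: right_descents_inv flip: inv_mult_group)

lemma parabolic_left_descent:
  assumes J: "J \<subseteq> S" and u: "u \<in> P J" "u \<noteq> \<one>"
  obtains s where "s \<in> J" "s \<in> LD u"
proof -
  have "u = \<one> \<or> (\<exists>s \<in> J. s \<in> LD u)"
    using J u(1)
  proof (induction u rule: parabolic_induct)
    case (step s u)
    then show ?case using J parabolic_carrier[of J u]
      by (intro disjI2 bexI[of _ s]) (auto simp: left_descents_def)
  qed simp
  then show thesis using that u(2) by blast
qed

text \<open>
  For a shortest element \<open>m\<close> of the coset \<open>W\<^sub>J x\<close>, exchange gives additivity of lengths, since a letter
  deleted in \<open>m\<close> would give a shorter element of the coset. Then \<open>x = m\<close>, because otherwise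
  \<open>x\<close> would inherit a left descent in \<open>J\<close> from its factor in \<open>W\<^sub>J\<close>.
\<close>

lemma len_left_min:
  assumes J: "J \<subseteq> S" and x: "x \<in> carrier G" and min: "J \<inter> LD x = {}" and u: "u \<in> P J"
  shows "\<ell> (u \<otimes> x) = \<ell> u + \<ell> x"
proof -
  obtain v where v: "v \<in> P J" and least: "\<And>v'. v' \<in> P J \<Longrightarrow> \<ell> (v \<otimes> x) \<le> \<ell> (v' \<otimes> x)"
    using ex_has_least_nat[of "\<lambda>v. v \<in> P J" \<one> "\<lambda>v. \<ell> (v \<otimes> x)"] by (auto intro: generate.one)
  have vc: "v \<in> carrier G" using v J parabolic_carrier by blast
  define m where "m = v \<otimes> x"
  have m: "m \<in> carrier G" using vc x by (simp add: m_def)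
  have add: "\<ell> (a \<otimes> m) = \<ell> a + \<ell> m" if "a \<in> P J" for a
    using J that
  proof (induction a rule: parabolic_induct)
    case one
    then show ?case using m by simp
  next
    case (step s a)
    have s: "s \<in> S" and a: "a \<in> carrier G" using step J parabolic_carrier by auto
    have "inv a \<otimes> s \<otimes> a \<otimes> v \<in> P J"
      using step(1,2) v J by (intro generate.eng parabolic_inv) (auto intro: generate.incl)
    from least[OF this] have "\<ell> m \<le> \<ell> (inv a \<otimes> s \<otimes> a \<otimes> m)"
      using s a vc x by (simp add: m_def m_assoc)
    then have "\<not> \<ell> (s \<otimes> a \<otimes> m) < \<ell> (a \<otimes> m)"
      using exchange_mult[OF s a m] step(3) by auto
    then show ?case using len_step[of s "a \<otimes> m"] s a m step by (simp add: m_assoc)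
  qed
  have "inv v = \<one>"
  proof (rule ccontr)
    assume "inv v \<noteq> \<one>"
    then obtain s where s: "s \<in> J" "s \<in> LD (inv v)"
      using parabolic_left_descent[OF J parabolic_inv[OF J v]] by blast
    have sS: "s \<in> S" using s J by auto
    have "s \<otimes> inv v \<in> P J" using s v J by (intro generate.eng parabolic_inv) (auto intro: generate.incl)
    from add[OF this] add[OF parabolic_inv[OF J v]] have "\<ell> (s \<otimes> x) < \<ell> x"
      using s sS vc x by (auto simp: m_def left_descents_def m_assoc)
    then show False using s sS min by (auto simp: left_descents_def)
  qed
  then have "m = x" using vc x by (metis inv_inv inv_one l_one m_def)
  then show ?thesis using add[OF u] by simp
qed

lemma len_right_max:
  assumes "J \<subseteq> S" "x \<in> carrier G" "J \<subseteq> RD x" "u \<in> P J"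
  shows "\<ell> (x \<otimes> u) + \<ell> u = \<ell> x"
  using len_left_max[of J "inv x" "inv u"] assms parabolic_inv parabolic_carrier[of J u] len_inv[of "x \<otimes> u"]
  by (simp add: left_descents_inv flip: inv_mult_group)

lemma len_right_min:
  assumes "J \<subseteq> S" "x \<in> carrier G" "J \<inter> RD x = {}" "u \<in> P J"
  shows "\<ell> (x \<otimes> u) = \<ell> x + \<ell> u"
  using len_left_min[of J "inv x" "inv u"] assms parabolic_inv parabolic_carrier[of J u] len_inv[of "x \<otimes> u"]
  by (simp add: left_descents_inv flip: inv_mult_group)

lemma left_min_unique:
  assumes J: "J \<subseteq> S" and "x \<in> carrier G" "u \<in> P J" "J \<inter> LD x = {}" "J \<inter> LD (u \<otimes> x) = {}"
  shows "u \<otimes> x = x"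
proof -
  have u: "u \<in> carrier G" using assms parabolic_carrier by blast
  have "\<ell> x = \<ell> (inv u) + \<ell> (u \<otimes> x)"
    using len_left_min[of J "u \<otimes> x" "inv u"] assms u parabolic_inv by simp
  then have "\<ell> u = 0" using len_left_min[of J x u] assms u by simp
  then show ?thesis using len_eq_0[OF u] assms by simp
qed

lemma left_max_unique:
  assumes J: "J \<subseteq> S" and "x \<in> carrier G" "u \<in> P J" "J \<subseteq> LD x" "J \<subseteq> LD (u \<otimes> x)"
  shows "u \<otimes> x = x"
proof -
  have u: "u \<in> carrier G" using assms parabolic_carrier by blast
  have "\<ell> x + \<ell> (inv u) = \<ell> (u \<otimes> x)"
    using len_left_max[of J "u \<otimes> x" "inv u"] assms u parabolic_inv by simp
  then have "\<ell> u = 0" using len_left_max[of J x u] assms u by simp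
  then show ?thesis using len_eq_0[OF u] assms by simp
qed

lemma right_min_unique:
  assumes J: "J \<subseteq> S" and "x \<in> carrier G" "u \<in> P J" "J \<inter> RD x = {}" "J \<inter> RD (x \<otimes> u) = {}"
  shows "x \<otimes> u = x"
proof -
  have u: "u \<in> carrier G" using assms parabolic_carrier by blast
  have "inv (x \<otimes> u) = inv x"
    using left_min_unique[of J "inv x" "inv u"] assms u parabolic_inv left_descents_inv[of "x \<otimes> u"]
    by (simp add: inv_mult_group left_descents_inv)
  then show ?thesis using u assms(2) by (metis inv_inv m_closed)
qed

section \<open>Longest elements\<close>

lemma finitary_subset: "finitary G S I \<Longrightarrow> I \<subseteq> S"
  by (simp add: finitary_def)

lemma finitary_mono:
  assumes "finitary G S J" "I \<subseteq> J" shows "finitary G S I"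
  using assms mono_generate[OF assms(2)] by (auto simp: finitary_def intro: finite_subset)

abbreviation longest_element ("w\<^sub>0") where "w\<^sub>0 \<equiv> longest G S"

context
  fixes I assumes fin: "finitary G S I"
begin

private lemmas subset = finitary_subset[OF fin]

lemma longest_props: "w\<^sub>0 I \<in> P I \<and> (\<forall>v \<in> P I. \<ell> v \<le> \<ell> (w\<^sub>0 I))"
proof -
  have fin_P: "finite (P I)" using fin by (simp add: finitary_def)
  have "P I \<noteq> {}" using generate.one by blast
  then have "Max (\<ell> ` P I) \<in> \<ell> ` P I" using fin_P by simp
  then obtain w where w: "w \<in> P I" "\<ell> w = Max (\<ell> ` P I)" by auto
  then have max: "\<forall>v \<in> P I. \<ell> v \<le> \<ell> w" using fin_P by simp
  have desc: "I \<subseteq> LD y" if y: "y \<in> P I" "\<forall>v \<in> P I. \<ell> v \<le> \<ell> y" for y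
  proof
    fix s assume s: "s \<in> I"
    have "s \<otimes> y \<in> P I" using s y by (intro generate.eng) (auto intro: generate.incl)
    then have "\<ell> (s \<otimes> y) \<le> \<ell> y" using y(2) by blast
    then show "s \<in> LD y"
      using not_left_descent[of s y] s subset parabolic_carrier[OF subset y(1)] by auto
  qed
  show ?thesis unfolding longest_def
  proof (rule theI)
    show "w \<in> P I \<and> (\<forall>v \<in> P I. \<ell> v \<le> \<ell> w)" using w max by blast
    fix y assume y: "y \<in> P I \<and> (\<forall>v \<in> P I. \<ell> v \<le> \<ell> y)"
    have c: "y \<in> carrier G" "w \<in> carrier G" using y w parabolic_carrier[OF subset] by auto
    have "y \<otimes> inv w \<in> P I" using y w parabolic_inv[OF subset] by (intro generate.eng) auto
    from left_max_unique[OF subset c(2) this] desc[of y] desc[of w] y w max c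
    show "y = w" by (simp add: m_assoc)
  qed
qed

lemma longest_in: "w\<^sub>0 I \<in> P I"
  using longest_props by blast

lemma longest_carrier [simp, intro]: "w\<^sub>0 I \<in> carrier G"
  using longest_in parabolic_carrier[OF subset] by blast

lemma longest_left_descents_subset: "I \<subseteq> LD (w\<^sub>0 I)"
proof
  fix s assume s: "s \<in> I"
  have "s \<otimes> w\<^sub>0 I \<in> P I" using s longest_in by (intro generate.eng) (auto intro: generate.incl)
  then have "\<ell> (s \<otimes> w\<^sub>0 I) \<le> \<ell> (w\<^sub>0 I)" using longest_props by blast
  then show "s \<in> LD (w\<^sub>0 I)" using not_left_descent[of s "w\<^sub>0 I"] s subset by auto
qed

lemma len_mult_longest: "u \<in> P I \<Longrightarrow> \<ell> (u \<otimes> w\<^sub>0 I) + \<ell> u = \<ell> (w\<^sub>0 I)"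
  using len_left_max[OF subset longest_carrier longest_left_descents_subset] .

lemma longest_square: "w\<^sub>0 I \<otimes> w\<^sub>0 I = \<one>"
  using len_mult_longest[OF longest_in] len_eq_0[of "w\<^sub>0 I \<otimes> w\<^sub>0 I"] by simp

lemma longest_inv [simp]: "inv (w\<^sub>0 I) = w\<^sub>0 I"
  using longest_square by (simp add: inv_equality)

lemma longest_square_left [simp]: "x \<in> carrier G \<Longrightarrow> w\<^sub>0 I \<otimes> (w\<^sub>0 I \<otimes> x) = x"
  using longest_square by (simp flip: m_assoc)

lemma longest_left_descents: "LD (w\<^sub>0 I) = I"
proof
  show "LD (w\<^sub>0 I) \<subseteq> I"
  proof
    fix s assume s: "s \<in> LD (w\<^sub>0 I)"
    then have sS: "s \<in> S" by (auto simp: left_descents_def)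
    obtain xs where xs: "set xs \<subseteq> I" "wp xs = w\<^sub>0 I"
      by (rule parabolic_reduced_word[OF subset longest_in])
    obtain us x vs where "xs = us @ x # vs" "s \<otimes> w\<^sub>0 I = wp (us @ vs)"
      using exchange[of xs s] s sS xs subset_trans[OF xs(1) subset] by (auto simp: left_descents_def)
    then have "s \<otimes> w\<^sub>0 I \<in> P I" using wp_in_parabolic[of "us @ vs" I] xs by auto
    then have "s \<otimes> w\<^sub>0 I \<otimes> w\<^sub>0 I \<in> P I" using longest_in by (rule generate.eng)
    then have "s \<in> P I" using sS longest_square by (simp add: m_assoc)
    then show "s \<in> I" using generator_in_parabolic subset sS by blast
  qed
qed (rule longest_left_descents_subset)

lemma longest_right_descents: "RD (w\<^sub>0 I) = I"
  using left_descents_inv[OF longest_carrier] longest_left_descents by simp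

lemma longest_left_max_to_min:
  assumes x: "x \<in> carrier G" and max: "I \<subseteq> LD x"
  shows "I \<inter> LD (w\<^sub>0 I \<otimes> x) = {}"
proof -
  have "s \<notin> LD (w\<^sub>0 I \<otimes> x)" if s: "s \<in> I" for s
  proof -
    have sS: "s \<in> S" using s subset by auto
    have "s \<otimes> w\<^sub>0 I \<in> P I" using s longest_in by (intro generate.eng) (auto intro: generate.incl)
    from len_left_max[OF subset x max this] len_left_max[OF subset x max longest_in]
      len_mult_longest[of s] sS s generate.incl[of s I G]
    show ?thesis using x by (auto simp: left_descents_def m_assoc)
  qed
  then show ?thesis by blast
qed

lemma longest_left_min_to_max:
  assumes x: "x \<in> carrier G" and min: "I \<inter> LD x = {}"
  shows "I \<subseteq> LD (w\<^sub>0 I \<otimes> x)"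
  using left_descents_mult[OF longest_carrier x] len_left_min[OF subset x min longest_in]
    longest_left_descents by simp

lemma longest_right_max_to_min:
  assumes x: "x \<in> carrier G" and max: "I \<subseteq> RD x"
  shows "I \<inter> RD (x \<otimes> w\<^sub>0 I) = {}"
  using longest_left_max_to_min[of "inv x"] assms left_descents_inv[of x] left_descents_inv[of "x \<otimes> w\<^sub>0 I"]
  by (simp add: inv_mult_group)

lemma longest_right_min_to_max:
  assumes x: "x \<in> carrier G" and min: "I \<inter> RD x = {}"
  shows "I \<subseteq> RD (x \<otimes> w\<^sub>0 I)"
  using longest_left_min_to_max[of "inv x"] assms left_descents_inv[of x] left_descents_inv[of "x \<otimes> w\<^sub>0 I"]
  by (simp add: inv_mult_group)

end

section \<open>Extremal elements of double cosets\<close>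

definition bi_minimal where
  "bi_minimal J K x \<longleftrightarrow> x \<in> carrier G \<and> J \<inter> LD x = {} \<and> K \<inter> RD x = {}"

definition bi_maximal where
  "bi_maximal J K x \<longleftrightarrow> x \<in> carrier G \<and> J \<subseteq> LD x \<and> K \<subseteq> RD x"

abbreviation DC where "DC \<equiv> double_coset G"

lemma double_coset_iff:
  "y \<in> DC J K x \<longleftrightarrow> (\<exists>a \<in> P J. \<exists>b \<in> P K. y = a \<otimes> x \<otimes> b)"
  by (auto simp: double_coset_def r_coset_def set_mult_def)

lemma double_cosetI: "a \<in> P J \<Longrightarrow> b \<in> P K \<Longrightarrow> a \<otimes> x \<otimes> b \<in> DC J K x"
  unfolding double_coset_iff by blast

lemma double_coset_carrier: "J \<subseteq> S \<Longrightarrow> K \<subseteq> S \<Longrightarrow> x \<in> carrier G \<Longrightarrow> DC J K x \<subseteq> carrier G"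
  using parabolic_carrier by (auto simp: double_coset_iff)

lemma double_coset_refl: "x \<in> carrier G \<Longrightarrow> x \<in> DC J K x"
  unfolding double_coset_iff by (intro bexI[of _ \<one>]) (auto intro: generate.one)

lemma double_coset_closed:
  assumes "J \<subseteq> S" "K \<subseteq> S" "x \<in> carrier G" "y \<in> DC J K x" "a \<in> P J" "b \<in> P K"
  shows "a \<otimes> y \<otimes> b \<in> DC J K x"
proof -
  obtain c d where cd: "c \<in> P J" "d \<in> P K" "y = c \<otimes> x \<otimes> d" using assms(4) by (auto simp: double_coset_iff)
  have "a \<otimes> y \<otimes> b = (a \<otimes> c) \<otimes> x \<otimes> (d \<otimes> b)"
    using cd assms parabolic_carrier[of J] parabolic_carrier[of K] by (simp add: m_assoc)
  then show ?thesis
    using double_cosetI[OF generate.eng[OF assms(5) cd(1)] generate.eng[OF cd(2) assms(6)]] by simp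
qed

lemma double_coset_sym:
  assumes "J \<subseteq> S" "K \<subseteq> S" "x \<in> carrier G" "y \<in> DC J K x"
  shows "x \<in> DC J K y"
proof -
  obtain c d where cd: "c \<in> P J" "d \<in> P K" "y = c \<otimes> x \<otimes> d" using assms(4) by (auto simp: double_coset_iff)
  have "x = inv c \<otimes> y \<otimes> inv d"
    using cd assms parabolic_carrier[of J] parabolic_carrier[of K] by (simp add: m_assoc)
  then show ?thesis
    using double_cosetI[OF parabolic_inv[OF assms(1) cd(1)] parabolic_inv[OF assms(2) cd(2)]] by simp
qed

lemma double_coset_eq:
  assumes "J \<subseteq> S" "K \<subseteq> S" "x \<in> carrier G" "y \<in> DC J K x"
  shows "DC J K y = DC J K x"
proof -
  have sub: "DC J K v \<subseteq> DC J K u" if "u \<in> carrier G" "v \<in> DC J K u" for u v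
    using double_coset_closed[OF assms(1,2) that] by (auto simp: double_coset_iff[of _ J K v])
  have "y \<in> carrier G" using double_coset_carrier assms by blast
  then show ?thesis using sub[of x y] sub[of y x] double_coset_sym[OF assms] assms by blast
qed

lemma double_coset_left: 
  assumes "J \<subseteq> S" "K \<subseteq> S" "x \<in> carrier G" "y \<in> DC J K x" "a \<in> P J"
  shows "a \<otimes> y \<in> DC J K x"
  using double_coset_closed[OF assms generate.one] assms double_coset_carrier[OF assms(1-3)]
    parabolic_carrier[OF assms(1,5)] by auto

lemma double_coset_right: 
  assumes "J \<subseteq> S" "K \<subseteq> S" "x \<in> carrier G" "y \<in> DC J K x" "b \<in> P K"
  shows "y \<otimes> b \<in> DC J K x"
  using double_coset_closed[OF assms(1-4) generate.one assms(5)] assms double_coset_carrier[OF assms(1-3)]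
    parabolic_carrier[OF assms(2,5)] by auto

text \<open>
  If \<open>s v\<close> has a right descent \<open>r \<in> K\<close>, lengths force \<open>s v r\<close> to be shorter than \<open>v r\<close> while \<open>s v\<close>
  is longer than \<open>v\<close>. So the exchange of \<open>s\<close> in \<open>v r\<close> deletes the last letter \<open>r\<close>.
\<close>

lemma deodhar_lemma:
  assumes K: "K \<subseteq> S" and v: "v \<in> carrier G" and min: "K \<inter> RD v = {}" and s: "s \<in> S"
    and not_min: "K \<inter> RD (s \<otimes> v) \<noteq> {}"
  shows "\<exists>r \<in> K. s \<otimes> v = v \<otimes> r"
proof -
  obtain r where r: "r \<in> K" "r \<in> S" "\<ell> (s \<otimes> v \<otimes> r) < \<ell> (s \<otimes> v)"
    using not_min K by (auto simp: right_descents_def)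
  have up: "\<ell> (v \<otimes> r) = Suc (\<ell> v)" using not_right_descent[of r v] r min v by auto
  have "\<ell> (s \<otimes> v) \<le> Suc (\<ell> v)" using len_step[OF s v] by auto
  moreover have "\<ell> (s \<otimes> (v \<otimes> r)) = Suc (\<ell> (v \<otimes> r)) \<or> \<ell> (v \<otimes> r) = Suc (\<ell> (s \<otimes> (v \<otimes> r)))"
    using len_step s v r by simp
  ultimately have "\<ell> (s \<otimes> v \<otimes> r) = \<ell> v" "\<ell> (s \<otimes> v) = Suc (\<ell> v)"
    using r up s v by (auto simp: m_assoc)
  then have "\<ell> (inv v \<otimes> s \<otimes> v \<otimes> r) = 0"
    using exchange_mult[OF s v, of r] r up by auto
  then have "inv v \<otimes> s \<otimes> v \<otimes> r = \<one>" using len_eq_0 s v r by simp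
  then have "s \<otimes> v = v \<otimes> r"
    using s v r by (metis S_carrier S_inv inv_closed inv_equality inv_inv inv_mult_cancel_left(2) m_assoc m_closed)
  then show ?thesis using r by blast
qed

text \<open>
  Build \<open>a \<in> W\<^sub>J\<close> letter by letter and watch the shortest element of the coset \<open>a m W\<^sub>K\<close>: by Deodhar's
  lemma each letter either multiplies it from the left or can be moved past it into \<open>W\<^sub>K\<close>.
\<close>

lemma right_min_in_double_coset:
  assumes J: "J \<subseteq> S" and K: "K \<subseteq> S" and m: "m \<in> carrier G" "K \<inter> RD m = {}"
    and y: "y \<in> DC J K m" "K \<inter> RD y = {}"
  shows "\<exists>a \<in> P J. y = a \<otimes> m"
proof -
  have rep: "\<exists>c \<in> P J. \<exists>d \<in> P K. a \<otimes> m = c \<otimes> m \<otimes> d \<and> K \<inter> RD (c \<otimes> m) = {}" if "a \<in> P J" for a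
    using J that
  proof (induction a rule: parabolic_induct)
    case one
    show ?case using m by (intro bexI[of _ \<one>]) (auto intro: generate.one)
  next
    case (step s a)
    then obtain c d where cd: "c \<in> P J" "d \<in> P K" "a \<otimes> m = c \<otimes> m \<otimes> d" "K \<inter> RD (c \<otimes> m) = {}" by blast
    have s: "s \<in> S" and carr: "a \<in> carrier G" "c \<in> carrier G" "d \<in> carrier G"
      using step cd J K parabolic_carrier by auto
    have sam: "s \<otimes> a \<otimes> m = s \<otimes> (c \<otimes> m) \<otimes> d" using cd(3) s carr m by (simp add: m_assoc)
    show ?case
    proof (cases "K \<inter> RD (s \<otimes> (c \<otimes> m)) = {}")
      case True
      have "s \<otimes> c \<in> P J" using step(1) cd(1) by (auto intro: generate.eng generate.incl)
      then show ?thesis using True sam cd(2) s carr m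
        by (intro bexI[of _ "s \<otimes> c"] bexI[of _ d]) (auto simp: m_assoc)
    next
      case False
      then obtain r where r: "r \<in> K" "s \<otimes> (c \<otimes> m) = c \<otimes> m \<otimes> r"
        using deodhar_lemma[OF K _ cd(4) s] carr m by auto
      have "r \<otimes> d \<in> P K" using r(1) cd(2) by (auto intro: generate.eng generate.incl)
      moreover have "s \<otimes> a \<otimes> m = c \<otimes> m \<otimes> (r \<otimes> d)"
        using sam r K carr m by (auto simp: m_assoc)
      ultimately show ?thesis using cd by blast
    qed
  qed
  obtain a b where ab: "a \<in> P J" "b \<in> P K" "y = a \<otimes> m \<otimes> b" using y by (auto simp: double_coset_iff)
  obtain c d where cd: "c \<in> P J" "d \<in> P K" "a \<otimes> m = c \<otimes> m \<otimes> d" "K \<inter> RD (c \<otimes> m) = {}"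
    using rep[OF ab(1)] by blast
  have carr: "c \<in> carrier G" "d \<in> carrier G" "b \<in> carrier G"
    using ab cd J K parabolic_carrier by auto
  have "y = c \<otimes> m \<otimes> (d \<otimes> b)" using ab cd carr m by (simp add: m_assoc)
  moreover have "d \<otimes> b \<in> P K" using ab cd by (intro generate.eng)
  ultimately have "y = c \<otimes> m"
    using right_min_unique[OF K, of "c \<otimes> m" "d \<otimes> b"] cd(4) y(2) carr m by auto
  then show ?thesis using cd by blast
qed

lemma bi_minimal_unique:
  assumes J: "J \<subseteq> S" and K: "K \<subseteq> S" and m: "bi_minimal J K m"
    and y: "bi_minimal J K y" "y \<in> DC J K m"
  shows "y = m"
proof -
  obtain a where "a \<in> P J" "y = a \<otimes> m"
    using right_min_in_double_coset[OF J K, of m y] m y by (auto simp: bi_minimal_def)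
  then show ?thesis using left_min_unique[OF J, of m a] m y by (auto simp: bi_minimal_def)
qed

text \<open>
  The value of \<open>left_redundancy\<close> on the \<open>(J, K)\<close>-coset with minimal element \<open>m\<close>.
\<close>

abbreviation redundancy where
  "redundancy J K m \<equiv> J \<inter> (\<lambda>s. m \<otimes> s \<otimes> inv m) ` K"

context
  fixes J K m
  assumes J: "finitary G S J" and K: "finitary G S K" and m: "bi_minimal J K m"
begin

private abbreviation "L \<equiv> redundancy J K m"

private lemma facts: "J \<subseteq> S" "K \<subseteq> S" "m \<in> carrier G" "J \<inter> LD m = {}" "K \<inter> RD m = {}"
  "w\<^sub>0 J \<in> carrier G" "w\<^sub>0 K \<in> carrier G"
  using J K m finitary_subset longest_carrier by (auto simp: bi_minimal_def)

lemma redundancy_finitary: "finitary G S L"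
  using finitary_mono[OF J] by blast

lemma redundancy_conj:
  assumes "s \<in> L" obtains r where "r \<in> K" "s \<otimes> m = m \<otimes> r"
  using assms facts that by (auto simp: m_assoc)

lemma redundancy_left_descents: "L \<subseteq> LD (m \<otimes> w\<^sub>0 K)"
proof
  fix s assume s: "s \<in> L"
  then obtain r where r: "r \<in> K" "s \<otimes> m = m \<otimes> r" by (rule redundancy_conj)
  have rS: "r \<in> S" and sS: "s \<in> S" using r s facts by auto
  have "s \<otimes> (m \<otimes> w\<^sub>0 K) = m \<otimes> (r \<otimes> w\<^sub>0 K)"
    using r rS sS facts by (metis S_carrier m_assoc)
  moreover have "r \<otimes> w\<^sub>0 K \<in> P K" using r longest_in[OF K] by (auto intro: generate.eng generate.incl)
  moreover have "\<ell> (r \<otimes> w\<^sub>0 K) < \<ell> (w\<^sub>0 K)"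
    using longest_left_descents_subset[OF K] r by (auto simp: left_descents_def)
  ultimately show "s \<in> LD (m \<otimes> w\<^sub>0 K)"
    using len_right_min[OF facts(2,3,5)] longest_in[OF K] sS by (simp add: left_descents_def)
qed

text \<open>
  Since \<open>m\<^sup>-\<^sup>1 W\<^sub>L m \<subseteq> W\<^sub>K\<close>, the element \<open>w\<^sub>L m w\<^sub>K\<close> has the form \<open>m u\<close> with \<open>u \<in> W\<^sub>K\<close>. A generator
  \<open>s \<in> L\<close> is no left descent of it because \<open>w\<^sub>L\<close> has been stripped off \<open>m w\<^sub>K\<close>. For \<open>s \<in> J - L\<close>,
  Deodhar's lemma says that \<open>s m\<close> has no right descent in \<open>K\<close>, so \<open>s m u\<close> is longer than \<open>m u\<close>.
\<close>

lemma redundancy_stripped_left_min: "J \<inter> LD (w\<^sub>0 L \<otimes> (m \<otimes> w\<^sub>0 K)) = {}"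
proof -
  have L: "finitary G S L" by (rule redundancy_finitary)
  have "inv m \<otimes> v \<otimes> m \<in> P K" if "v \<in> P L" for v
    using finitary_subset[OF L] that
  proof (induction v rule: parabolic_induct)
    case one
    show ?case using facts by (auto intro: generate.one)
  next
    case (step s v)
    obtain r where r: "r \<in> K" "s \<otimes> m = m \<otimes> r" using step(1) by (rule redundancy_conj)
    have carr: "r \<in> S" "s \<in> S" "v \<in> carrier G"
      using r step facts parabolic_carrier[OF finitary_subset[OF L]] by auto
    have "r \<otimes> inv m = inv m \<otimes> (m \<otimes> r) \<otimes> inv m" using carr facts by (simp add: m_assoc)
    also have "\<dots> = inv m \<otimes> s" using carr facts by (simp add: m_assoc flip: r(2))
    finally have "inv m \<otimes> s \<otimes> (v \<otimes> m) = r \<otimes> inv m \<otimes> (v \<otimes> m)" by simp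
    then have "inv m \<otimes> (s \<otimes> v) \<otimes> m = r \<otimes> (inv m \<otimes> v \<otimes> m)"
      using carr facts by (simp add: m_assoc)
    then show ?case using step(4) r by (auto intro: generate.eng generate.incl)
  qed
  then have u: "inv m \<otimes> w\<^sub>0 L \<otimes> m \<otimes> w\<^sub>0 K \<in> P K"
    using longest_in[OF L] longest_in[OF K] by (auto intro: generate.eng)
  define u where "u = inv m \<otimes> w\<^sub>0 L \<otimes> m \<otimes> w\<^sub>0 K"
  have uK: "u \<in> P K" "u \<in> carrier G" using u facts longest_carrier[OF L] by (auto simp: u_def)
  have h: "w\<^sub>0 L \<otimes> (m \<otimes> w\<^sub>0 K) = m \<otimes> u"
    using facts longest_carrier[OF L] by (simp add: u_def m_assoc)
  have "s \<notin> LD (w\<^sub>0 L \<otimes> (m \<otimes> w\<^sub>0 K))" if s: "s \<in> J" for s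
  proof (cases "s \<in> L")
    case True
    then show ?thesis
      using longest_left_max_to_min[OF L _ redundancy_left_descents] facts by auto
  next
    case False
    have sS: "s \<in> S" using s facts by auto
    have "\<not> (\<exists>r \<in> K. s \<otimes> m = m \<otimes> r)"
    proof
      assume "\<exists>r \<in> K. s \<otimes> m = m \<otimes> r"
      then obtain r where r: "r \<in> K" "s \<otimes> m = m \<otimes> r" by blast
      then have "s = m \<otimes> r \<otimes> inv m" using sS facts by (metis S_carrier inv_solve_right' m_closed subsetD)
      then show False using False s r by blast
    qed
    then have min: "K \<inter> RD (s \<otimes> m) = {}" using deodhar_lemma[OF facts(2,3,5) sS] by blast
    have "\<ell> (s \<otimes> m \<otimes> u) = Suc (\<ell> (m \<otimes> u))"
      using len_right_min[OF facts(2) _ min uK(1)] len_right_min[OF facts(2,3,5) uK(1)]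
        not_left_descent[OF sS facts(3)] s sS facts by auto
    then show ?thesis
      unfolding h using not_left_descent[OF sS, of "m \<otimes> u"] facts sS uK by (simp add: m_assoc)
  qed
  then show ?thesis by blast
qed

text \<open>
  Dividing \<open>x\<close> by \<open>w\<^sub>K\<close> gives an element \<open>a m\<close> with \<open>a \<in> W\<^sub>J\<close>, so \<open>x\<close> lies in the coset
  \<open>W\<^sub>J w\<^sub>L m w\<^sub>K\<close>, in which both sides of the equation have \<open>J\<close> as left descents. In particular a
  double coset has only one element with maximal descents on both sides.
\<close>

lemma bi_maximal_eq:
  assumes x: "bi_maximal J K x" "x \<in> DC J K m"
  shows "x = w\<^sub>0 J \<otimes> (w\<^sub>0 L \<otimes> (m \<otimes> w\<^sub>0 K))"
proof -
  have L: "finitary G S L" by (rule redundancy_finitary)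
  have xc: "x \<in> carrier G" and xJ: "J \<subseteq> LD x" and xK: "K \<subseteq> RD x"
    using x by (auto simp: bi_maximal_def)
  let ?h = "w\<^sub>0 L \<otimes> (m \<otimes> w\<^sub>0 K)"
  have hc: "?h \<in> carrier G" using facts longest_carrier[OF L] by simp
  have "x \<otimes> w\<^sub>0 K \<in> DC J K m"
    using double_coset_right[OF facts(1-3) x(2) longest_in[OF K]] .
  then obtain a where a: "a \<in> P J" "x \<otimes> w\<^sub>0 K = a \<otimes> m"
    using right_min_in_double_coset[OF facts(1,2,3,5)] longest_right_max_to_min[OF K xc xK] by blast
  have ac: "a \<in> carrier G" using a facts parabolic_carrier by blast
  have "x = a \<otimes> m \<otimes> w\<^sub>0 K" using a(2) xc facts longest_square[OF K] by (metis m_assoc r_one)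
  then have xh: "x = (a \<otimes> w\<^sub>0 L \<otimes> w\<^sub>0 J) \<otimes> (w\<^sub>0 J \<otimes> ?h)"
    using ac facts longest_carrier[OF L] longest_square_left[OF J] longest_square_left[OF L] by (simp add: m_assoc)
  have "w\<^sub>0 L \<in> P J" using longest_in[OF L] mono_generate[of L J] by blast
  then have "a \<otimes> w\<^sub>0 L \<otimes> w\<^sub>0 J \<in> P J" using a longest_in[OF J] by (intro generate.eng)
  moreover have "J \<subseteq> LD (w\<^sub>0 J \<otimes> ?h)" using longest_left_min_to_max[OF J hc redundancy_stripped_left_min] .
  ultimately show ?thesis using left_max_unique[OF facts(1)] xh xJ hc facts by (metis m_closed)
qed

end

lemma bi_minimal_exists:
  assumes J: "J \<subseteq> S" and K: "K \<subseteq> S" and x: "x \<in> carrier G"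
  obtains m where "m \<in> DC J K x" "bi_minimal J K m" "\<And>y. y \<in> DC J K x \<Longrightarrow> \<ell> m \<le> \<ell> y"
proof -
  obtain m where m: "m \<in> DC J K x" and least: "\<And>y. y \<in> DC J K x \<Longrightarrow> \<ell> m \<le> \<ell> y"
    using ex_has_least_nat[of "\<lambda>y. y \<in> DC J K x" x \<ell>] double_coset_refl[OF x] by auto
  have "m \<in> carrier G" using m double_coset_carrier[OF J K x] by blast
  moreover have "s \<notin> LD m" if "s \<in> J" for s
    using least[OF double_coset_left[OF J K x m, of s]] that by (auto simp: left_descents_def generate.incl)
  moreover have "s \<notin> RD m" if "s \<in> K" for s
    using least[OF double_coset_right[OF J K x m, of s]] that by (auto simp: right_descents_def generate.incl)
  ultimately show thesis using that[OF m _ least] by (auto simp: bi_minimal_def)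
qed

lemma bi_maximal_unique:
  assumes J: "finitary G S J" and K: "finitary G S K"
    and x: "bi_maximal J K x" and y: "bi_maximal J K y" "y \<in> DC J K x"
  shows "y = x"
proof -
  have sub: "J \<subseteq> S" "K \<subseteq> S" "x \<in> carrier G" using assms finitary_subset by (auto simp: bi_maximal_def)
  obtain m where m: "m \<in> DC J K x" "bi_minimal J K m" using bi_minimal_exists[OF sub] by blast
  have "x \<in> DC J K m" "y \<in> DC J K m"
    using double_coset_sym[OF sub m(1)] double_coset_eq[OF sub m(1)] y by auto
  then show ?thesis using bi_maximal_eq[OF J K m(2) x] bi_maximal_eq[OF J K m(2) y(1)] by simp
qed

lemma bi_maximal_exists:
  assumes J: "finitary G S J" and K: "finitary G S K" and x: "x \<in> carrier G"
  obtains m where "m \<in> DC J K x" "bi_maximal J K m" "\<And>y. y \<in> DC J K x \<Longrightarrow> \<ell> y \<le> \<ell> m"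
proof -
  have sub: "J \<subseteq> S" "K \<subseteq> S" using assms finitary_subset by auto
  have "DC J K x = (\<Union>a \<in> P J. \<Union>b \<in> P K. {a \<otimes> x \<otimes> b})"
    unfolding set_eq_iff double_coset_iff by blast
  then have fin: "finite (DC J K x)" using J K by (simp add: finitary_def)
  have "Max (\<ell> ` DC J K x) \<in> \<ell> ` DC J K x" using fin double_coset_refl[OF x] by (intro Max_in) auto
  then obtain m where m: "m \<in> DC J K x" "\<ell> m = Max (\<ell> ` DC J K x)" by auto
  then have greatest: "\<ell> y \<le> \<ell> m" if "y \<in> DC J K x" for y using that fin by simp
  have mc: "m \<in> carrier G" using m double_coset_carrier[OF sub x] by blast
  have "s \<in> LD m" if "s \<in> J" for s
    using greatest[OF double_coset_left[OF sub x m(1), of s]] not_left_descent[of s m] that sub mc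
    by (auto simp: generate.incl)
  moreover have "s \<in> RD m" if "s \<in> K" for s
    using greatest[OF double_coset_right[OF sub x m(1), of s]] not_right_descent[of s m] that sub mc
    by (auto simp: generate.incl)
  ultimately show thesis using that[OF m(1) _ greatest] mc by (auto simp: bi_maximal_def)
qed

lemma bruhat_le_len: "bruhat_le G S u v \<Longrightarrow> u = v \<or> \<ell> u < \<ell> v"
  unfolding bruhat_le_def by (induction rule: rtranclp_induct) auto

lemma bruhat_le_left:
  assumes s: "s \<in> S" and u: "u \<in> carrier G" and less: "\<ell> u < \<ell> (s \<otimes> u)"
  shows "bruhat_le G S u (s \<otimes> u)"
proof -
  have "inv u \<otimes> s \<otimes> inv (inv u) \<in> reflections G S"
    unfolding reflections_def using s u by blast
  moreover have "s \<otimes> u = u \<otimes> (inv u \<otimes> s \<otimes> inv (inv u))" using s u by (simp add: m_assoc)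
  ultimately show ?thesis unfolding bruhat_le_def using less by blast
qed

lemma bruhat_le_right:
  assumes s: "s \<in> S" and u: "u \<in> carrier G" and less: "\<ell> u < \<ell> (u \<otimes> s)"
  shows "bruhat_le G S u (u \<otimes> s)"
proof -
  have "\<one> \<otimes> s \<otimes> inv \<one> \<in> reflections G S"
    unfolding reflections_def using s by blast
  then have "s \<in> reflections G S" using s by simp
  then show ?thesis unfolding bruhat_le_def using less by blast
qed

text \<open>
  Multiplying by a generator changes an element by a reflection, hence moves it up or down in
  Bruhat order. So Bruhat-minimal elements of a double coset have no descents in \<open>J\<close> and \<open>K\<close>, and
  only one element has none.
\<close>

lemma coset_min_eq:
  assumes J: "J \<subseteq> S" and K: "K \<subseteq> S" and x: "x \<in> carrier G"
    and m: "m \<in> DC J K x" "bi_minimal J K m"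
  shows "coset_min G S (DC J K x) = m"
  unfolding coset_min_def
proof (rule the_equality)
  have unique: "y = m" if "y \<in> DC J K x" "bi_minimal J K y" for y
    using bi_minimal_unique[OF J K m(2) that(2)] that(1) double_coset_eq[OF J K x m(1)] by simp
  then have least: "\<ell> m \<le> \<ell> y" if "y \<in> DC J K x" for y
    using that bi_minimal_exists[OF J K x] by metis
  show "m \<in> DC J K x \<and> (\<forall>y \<in> DC J K x. bruhat_le G S y m \<longrightarrow> y = m)"
    using m least bruhat_le_len by fastforce
  fix y assume y: "y \<in> DC J K x \<and> (\<forall>z \<in> DC J K x. bruhat_le G S z y \<longrightarrow> z = y)"
  then have yc: "y \<in> carrier G" using double_coset_carrier[OF J K x] by blast
  have "s \<notin> LD y" if s: "s \<in> J" for s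
  proof
    assume d: "s \<in> LD y"
    then have "bruhat_le G S (s \<otimes> y) y"
      using bruhat_le_left[of s "s \<otimes> y"] s J yc by (auto simp: left_descents_def)
    moreover have "s \<otimes> y \<in> DC J K x"
      using double_coset_left[OF J K x] y s by (auto intro: generate.incl)
    ultimately show False using y d by (auto simp: left_descents_def)
  qed
  moreover have "s \<notin> RD y" if s: "s \<in> K" for s
  proof
    assume d: "s \<in> RD y"
    have "s \<in> S" using s K by auto
    then have "bruhat_le G S (y \<otimes> s) y"
      using bruhat_le_right[of s "y \<otimes> s"] d yc by (auto simp: right_descents_def m_assoc)
    moreover have "y \<otimes> s \<in> DC J K x"
      using double_coset_right[OF J K x] y s by (auto intro: generate.incl)
    ultimately show False using y d by (auto simp: right_descents_def)
  qed
  ultimately have "bi_minimal J K y" using yc by (auto simp: bi_minimal_def)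
  then show "y = m" using unique y by blast
qed

lemma coset_max_eq:
  assumes J: "finitary G S J" and K: "finitary G S K" and x: "x \<in> carrier G"
    and m: "m \<in> DC J K x" "bi_maximal J K m"
  shows "coset_max G S (DC J K x) = m"
  unfolding coset_max_def
proof (rule the_equality)
  have sub: "J \<subseteq> S" "K \<subseteq> S" using assms finitary_subset by auto
  have unique: "y = m" if "y \<in> DC J K x" "bi_maximal J K y" for y
    using bi_maximal_unique[OF J K m(2) that(2)] that(1) double_coset_eq[OF sub x m(1)] by simp
  then have greatest: "\<ell> y \<le> \<ell> m" if "y \<in> DC J K x" for y
    using that bi_maximal_exists[OF J K x] by metis
  show "m \<in> DC J K x \<and> (\<forall>y \<in> DC J K x. bruhat_le G S m y \<longrightarrow> y = m)"
    using m greatest bruhat_le_len by fastforce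
  fix y assume y: "y \<in> DC J K x \<and> (\<forall>z \<in> DC J K x. bruhat_le G S y z \<longrightarrow> z = y)"
  then have yc: "y \<in> carrier G" using double_coset_carrier[OF sub x] by blast
  have "s \<in> LD y" if s: "s \<in> J" for s
  proof (rule ccontr)
    assume "s \<notin> LD y"
    then have d: "\<ell> (s \<otimes> y) = Suc (\<ell> y)" using not_left_descent[of s y] s sub yc by auto
    then have "bruhat_le G S y (s \<otimes> y)"
      using bruhat_le_left[of s y] s sub yc by auto
    moreover have "s \<otimes> y \<in> DC J K x"
      using double_coset_left[OF sub x] y s by (auto intro: generate.incl)
    ultimately show False using y d by auto
  qed
  moreover have "s \<in> RD y" if s: "s \<in> K" for s
  proof (rule ccontr)
    assume "s \<notin> RD y"
    then have d: "\<ell> (y \<otimes> s) = Suc (\<ell> y)" using not_right_descent[of s y] s sub yc by auto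
    then have "bruhat_le G S y (y \<otimes> s)"
      using bruhat_le_right[of s y] s sub yc by auto
    moreover have "y \<otimes> s \<in> DC J K x"
      using double_coset_right[OF sub x] y s by (auto intro: generate.incl)
    ultimately show False using y d by auto
  qed
  ultimately have "bi_maximal J K y" using yc by (auto simp: bi_maximal_def)
  then show "y = m" using unique y by blast
qed

end

section \<open>Reduced expressions, one step at a time\<close>

text \<open>
  Apart from conditions on single entries, \<open>singular_expression\<close>, \<open>forward_path\<close> and
  \<open>reduced_expression_for\<close> only compare neighbours. Gathering these comparisons in a single relation between neighbours allows induction
  from the right end of an expression.
\<close>

definition reduced_step where
  "reduced_step G S J I I' p p' \<longleftrightarrow>
    (\<exists>s \<in> S. s \<notin> I \<and> I' = insert s I \<or> s \<in> I \<and> I' = I - {s}) \<and>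
    (I \<subset> I' \<longrightarrow> p \<subseteq> p' \<and> coset_min G S p = coset_min G S p' \<and>
      left_redundancy G S J I p = left_redundancy G S J I' p') \<and>
    (I' \<subset> I \<longrightarrow> coset_max G S p \<in> p')"

definition reduced_path where
  "reduced_path G S J Is ps \<longleftrightarrow> length ps = length Is \<and> \<one>\<^bsub>G\<^esub> \<in> hd ps \<and>
    (\<forall>i < length Is. ps ! i \<in> double_cosets G J (Is ! i)) \<and>
    (\<forall>i. Suc i < length Is \<longrightarrow> reduced_step G S J (Is ! i) (Is ! Suc i) (ps ! i) (ps ! Suc i))"

lemma reduced_expression_for_iff_path:
  "reduced_expression_for G S Is J I p \<longleftrightarrow>
    Is \<noteq> [] \<and> hd Is = J \<and> last Is = I \<and> (\<forall>I \<in> set Is. finitary G S I) \<and>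
    (\<exists>ps. reduced_path G S J Is ps \<and> last ps = p)"
  unfolding reduced_expression_for_def singular_expression_def forward_path_def reduced_step_def
    reduced_path_def
  by (rule iffI; (elim conjE exE; intro conjI exI; simp?)) blast+

lemma all_steps_snoc:
  assumes "xs \<noteq> []" "length ys = length xs"
  shows "(\<forall>i. Suc i < length (xs @ [x]) \<longrightarrow>
      Q ((xs @ [x]) ! i) ((xs @ [x]) ! Suc i) ((ys @ [y]) ! i) ((ys @ [y]) ! Suc i)) \<longleftrightarrow>
    (\<forall>i. Suc i < length xs \<longrightarrow> Q (xs ! i) (xs ! Suc i) (ys ! i) (ys ! Suc i)) \<and>
      Q (last xs) x (last ys) y" (is "?l \<longleftrightarrow> ?r1 \<and> ?r2")
proof (intro iffI conjI)
  assume l: ?l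
  show ?r1
  proof (intro allI impI)
    fix i assume "Suc i < length xs"
    then show "Q (xs ! i) (xs ! Suc i) (ys ! i) (ys ! Suc i)"
      using l[rule_format, of i] assms by (simp add: nth_append)
  qed
  have ne: "ys \<noteq> []" using assms by auto
  show ?r2
    using l[rule_format, of "length xs - 1"] assms ne
    by (simp add: nth_append last_conv_nth)
next
  assume r: "?r1 \<and> ?r2"
  have ne: "ys \<noteq> []" using assms by auto
  show ?l
  proof (intro allI impI)
    fix i assume i: "Suc i < length (xs @ [x])"
    show "Q ((xs @ [x]) ! i) ((xs @ [x]) ! Suc i) ((ys @ [y]) ! i) ((ys @ [y]) ! Suc i)"
    proof (cases "Suc i < length xs")
      case True
      then show ?thesis using r assms by (simp add: nth_append)
    next
      case False
      then have "i = length xs - 1" using i assms by simp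
      then show ?thesis using r assms ne by (simp add: nth_append last_conv_nth)
    qed
  qed
qed

lemma reduced_path_snoc:
  assumes "Is \<noteq> []" "length qs = length Is"
  shows "reduced_path G S J (Is @ [I]) (qs @ [p]) \<longleftrightarrow>
    reduced_path G S J Is qs \<and> p \<in> double_cosets G J I \<and> reduced_step G S J (last Is) I (last qs) p"
proof -
  have "(\<forall>i < length (Is @ [I]). (qs @ [p]) ! i \<in> double_cosets G J ((Is @ [I]) ! i)) \<longleftrightarrow>
      (\<forall>i < length Is. qs ! i \<in> double_cosets G J (Is ! i)) \<and> p \<in> double_cosets G J I"
    using assms(2) by (simp add: nth_append All_less_Suc conj_commute)
  moreover have "hd (qs @ [p]) = hd qs" using assms by (cases qs) auto
  ultimately show ?thesis
    unfolding reduced_path_def all_steps_snoc[OF assms] using assms(2) by auto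
qed

lemma reduced_expression_for_singleton:
  "reduced_expression_for G S [I] J K p \<longleftrightarrow>
    I = J \<and> K = J \<and> finitary G S J \<and> p \<in> double_cosets G J J \<and> \<one>\<^bsub>G\<^esub> \<in> p"
  unfolding reduced_expression_for_iff_path reduced_path_def
  by (auto simp: length_Suc_conv intro!: exI[of _ "[p]"])

lemma reduced_expression_for_snoc:
  assumes "Is \<noteq> []"
  shows "reduced_expression_for G S (Is @ [I]) J K p \<longleftrightarrow>
    K = I \<and> finitary G S I \<and> p \<in> double_cosets G J I \<and>
    (\<exists>p'. reduced_expression_for G S Is J (last Is) p' \<and> reduced_step G S J (last Is) I p' p)"
proof -
  have "(\<exists>ps. reduced_path G S J (Is @ [I]) ps \<and> last ps = p) \<longleftrightarrow>
      (\<exists>qs. reduced_path G S J (Is @ [I]) (qs @ [p]) \<and> length qs = length Is)"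
  proof
    assume "\<exists>ps. reduced_path G S J (Is @ [I]) ps \<and> last ps = p"
    then obtain ps where ps: "reduced_path G S J (Is @ [I]) ps" "last ps = p" by blast
    then have len: "length ps = Suc (length Is)" by (simp add: reduced_path_def)
    then have "ps \<noteq> []" by auto
    then have "ps = butlast ps @ [p]" using ps(2) by (metis append_butlast_last_id)
    then show "\<exists>qs. reduced_path G S J (Is @ [I]) (qs @ [p]) \<and> length qs = length Is"
      using ps(1) len by (intro exI[of _ "butlast ps"]) simp
  next
    assume "\<exists>qs. reduced_path G S J (Is @ [I]) (qs @ [p]) \<and> length qs = length Is"
    then show "\<exists>ps. reduced_path G S J (Is @ [I]) ps \<and> last ps = p" by (metis last_snoc)
  qed
  also have "\<dots> \<longleftrightarrow> (\<exists>qs. reduced_path G S J Is qs \<and> p \<in> double_cosets G J I \<and>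
      reduced_step G S J (last Is) I (last qs) p)"
    using reduced_path_snoc[OF assms] by (metis reduced_path_def)
  finally show ?thesis
    unfolding reduced_expression_for_iff_path using assms by auto
qed

context coxeter_system
begin

lemma coset_min_props:
  assumes J: "J \<subseteq> S" and K: "K \<subseteq> S" and x: "x \<in> carrier G"
  shows "coset_min G S (DC J K x) \<in> DC J K x" "bi_minimal J K (coset_min G S (DC J K x))"
proof -
  obtain m where "m \<in> DC J K x" "bi_minimal J K m" using bi_minimal_exists[OF J K x] by blast
  with coset_min_eq[OF J K x this]
  show "coset_min G S (DC J K x) \<in> DC J K x" "bi_minimal J K (coset_min G S (DC J K x))" by auto
qed

lemma coset_max_props:
  assumes J: "finitary G S J" and K: "finitary G S K" and x: "x \<in> carrier G"
  shows "coset_max G S (DC J K x) \<in> DC J K x" "bi_maximal J K (coset_max G S (DC J K x))"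
proof -
  obtain m where "m \<in> DC J K x" "bi_maximal J K m" using bi_maximal_exists[OF J K x] by blast
  with coset_max_eq[OF J K x this]
  show "coset_max G S (DC J K x) \<in> DC J K x" "bi_maximal J K (coset_max G S (DC J K x))" by auto
qed

lemma double_coset_mono: "I \<subseteq> K \<Longrightarrow> DC J I x \<subseteq> DC J K x"
  using mono_generate[of I K] unfolding subset_iff double_coset_iff by blast

text \<open>
  Lengths add up in \<open>x \<cdot> (w\<^sub>I w\<^sub>K)\<close>, so this product keeps the left descents of \<open>x\<close>.
\<close>

lemma growth_bi_maximal:
  assumes K: "finitary G S K" and I: "I \<subseteq> K"
    and x: "bi_maximal J I x" and min: "K \<inter> RD (x \<otimes> w\<^sub>0 I) = {}"
  shows "bi_maximal J K (x \<otimes> w\<^sub>0 I \<otimes> w\<^sub>0 K)"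
proof -
  have Ifin: "finitary G S I" using finitary_mono[OF K I] .
  have Isub: "I \<subseteq> S" and Ksub: "K \<subseteq> S" using Ifin K finitary_subset by auto
  have xc: "x \<in> carrier G" and xJ: "J \<subseteq> LD x" and xI: "I \<subseteq> RD x" using x by (auto simp: bi_maximal_def)
  let ?y = "x \<otimes> w\<^sub>0 I"
  have c: "?y \<in> carrier G" "w\<^sub>0 I \<in> carrier G" "w\<^sub>0 K \<in> carrier G"
    using xc longest_carrier[OF Ifin] longest_carrier[OF K] by auto
  have IK: "w\<^sub>0 I \<in> P K" using longest_in[OF Ifin] mono_generate[OF I] by blast
  have u: "w\<^sub>0 I \<otimes> w\<^sub>0 K \<in> P K" using IK longest_in[OF K] by (rule generate.eng)
  have "\<ell> (?y \<otimes> w\<^sub>0 K) = \<ell> ?y + \<ell> (w\<^sub>0 K)"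
    using len_right_min[OF Ksub c(1) min longest_in[OF K]] .
  moreover have "\<ell> x = \<ell> ?y + \<ell> (w\<^sub>0 I)" using len_right_max[OF Isub xc xI longest_in[OF Ifin]] by simp
  moreover have "\<ell> (w\<^sub>0 I \<otimes> w\<^sub>0 K) + \<ell> (w\<^sub>0 I) = \<ell> (w\<^sub>0 K)" using len_mult_longest[OF K IK] .
  moreover have eq: "?y \<otimes> w\<^sub>0 K = x \<otimes> (w\<^sub>0 I \<otimes> w\<^sub>0 K)" using xc c by (simp add: m_assoc)
  ultimately have "\<ell> (x \<otimes> (w\<^sub>0 I \<otimes> w\<^sub>0 K)) = \<ell> x + \<ell> (w\<^sub>0 I \<otimes> w\<^sub>0 K)" by simp
  then have "LD x \<subseteq> LD (?y \<otimes> w\<^sub>0 K)"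
    unfolding eq using left_descents_mult xc c by auto
  then show ?thesis using longest_right_min_to_max[OF K c(1) min] xJ c by (auto simp: bi_maximal_def)
qed

text \<open>
  Let \<open>m\<close>, \<open>n\<close> be the minimal elements of the two cosets, \<open>L\<close>, \<open>L'\<close> their redundancies and \<open>x'\<close> the
  maximal element of the larger coset. By \<open>bi_maximal_eq\<close> the stripped maxima are
  \<open>x w\<^sub>I = w\<^sub>J w\<^sub>L m\<close> and \<open>x' w\<^sub>K = w\<^sub>J w\<^sub>L\<^sub>' n\<close>. The pairs \<open>(m, L)\<close> and \<open>(n, L')\<close> can be read off from these
  products, so they agree if and only if the products do; and as \<open>x' w\<^sub>K\<close> has no right descents in
  \<open>K\<close>, the products agree if and only if \<open>x w\<^sub>I\<close> has none either.
\<close>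

lemma reduced_growth_iff:
  assumes J: "finitary G S J" and K: "finitary G S K" and I: "I \<subseteq> K" and x: "bi_maximal J I x"
  shows "coset_min G S (DC J I x) = coset_min G S (DC J K x) \<and>
      left_redundancy G S J I (DC J I x) = left_redundancy G S J K (DC J K x) \<longleftrightarrow>
    K \<inter> RD (x \<otimes> w\<^sub>0 I) = {}"
proof -
  have Ifin: "finitary G S I" using finitary_mono[OF K I] .
  have Jsub: "J \<subseteq> S" and Isub: "I \<subseteq> S" and Ksub: "K \<subseteq> S" using J Ifin K finitary_subset by auto
  have xc: "x \<in> carrier G" using x by (simp add: bi_maximal_def)
  have c: "w\<^sub>0 J \<in> carrier G" "w\<^sub>0 I \<in> carrier G" "w\<^sub>0 K \<in> carrier G"
    using longest_carrier[OF Ifin] longest_carrier[OF J] longest_carrier[OF K] by auto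
  let ?y = "x \<otimes> w\<^sub>0 I"
  have strip: "v \<otimes> w\<^sub>0 M = w\<^sub>0 J \<otimes> (w\<^sub>0 (redundancy J M n) \<otimes> n)"
    if M: "finitary G S M" and n: "bi_minimal J M n" "n \<in> DC J M u" and u: "u \<in> carrier G"
      and v: "bi_maximal J M v" "v \<in> DC J M u" for M n u v
  proof -
    have Msub: "M \<subseteq> S" using M finitary_subset by auto
    have "v = w\<^sub>0 J \<otimes> (w\<^sub>0 (redundancy J M n) \<otimes> (n \<otimes> w\<^sub>0 M))"
      using bi_maximal_eq[OF J M n(1) v(1)] v(2) double_coset_eq[OF Jsub Msub u n(2)] by simp
    moreover have "n \<in> carrier G" using n by (simp add: bi_minimal_def)
    ultimately show ?thesis
      using longest_carrier[OF J] longest_carrier[OF M] longest_square[OF M]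
        longest_carrier[OF redundancy_finitary[OF J M n(1)]] by (simp add: m_assoc)
  qed
  define m where "m = coset_min G S (DC J I x)"
  define n where "n = coset_min G S (DC J K x)"
  have m: "m \<in> DC J I x" "bi_minimal J I m" and n: "n \<in> DC J K x" "bi_minimal J K n"
    unfolding m_def n_def using coset_min_props[OF Jsub Isub xc] coset_min_props[OF Jsub Ksub xc] by auto
  obtain x' where x': "x' \<in> DC J K x" "bi_maximal J K x'"
    using bi_maximal_exists[OF J K xc] by blast
  have x'c: "x' \<in> carrier G" using x' by (simp add: bi_maximal_def)
  define L where "L = redundancy J I m"
  define L' where "L' = redundancy J K n"
  have Lfin: "finitary G S L" "finitary G S L'"
    unfolding L_def L'_def using redundancy_finitary[OF J Ifin m(2)] redundancy_finitary[OF J K n(2)] by auto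
  have y: "?y = w\<^sub>0 J \<otimes> (w\<^sub>0 L \<otimes> m)"
    unfolding L_def using strip[OF Ifin m(2,1) xc x] double_coset_refl[OF xc] by simp
  have y': "x' \<otimes> w\<^sub>0 K = w\<^sub>0 J \<otimes> (w\<^sub>0 L' \<otimes> n)"
    unfolding L'_def using strip[OF K n(2,1) xc x'(2,1)] .
  have "m = n \<and> L = L' \<longleftrightarrow> K \<inter> RD ?y = {}"
  proof
    assume "m = n \<and> L = L'"
    then have "?y = x' \<otimes> w\<^sub>0 K" using y y' by simp
    then show "K \<inter> RD ?y = {}"
      using longest_right_max_to_min[OF K x'c] x'(2) by (simp add: bi_maximal_def)
  next
    assume min: "K \<inter> RD ?y = {}"
    have "w\<^sub>0 I \<otimes> w\<^sub>0 K \<in> P K"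
      using longest_in[OF Ifin] longest_in[OF K] mono_generate[OF I] by (auto intro: generate.eng)
    then have "?y \<otimes> w\<^sub>0 K \<in> DC J K x"
      using double_coset_right[OF Jsub Ksub xc double_coset_refl[OF xc], of "w\<^sub>0 I \<otimes> w\<^sub>0 K"] xc c
      by (simp add: m_assoc)
    then have "?y \<otimes> w\<^sub>0 K = x'"
      using bi_maximal_unique[OF J K x'(2) growth_bi_maximal[OF K I x min]]
        double_coset_eq[OF Jsub Ksub xc x'(1)] by simp
    then have "?y = x' \<otimes> w\<^sub>0 K" using xc c longest_square[OF K] by (metis m_assoc m_closed r_one)
    then have eq: "w\<^sub>0 L \<otimes> m = w\<^sub>0 L' \<otimes> n"
      using y y' c m n longest_carrier[OF Lfin(1)] longest_carrier[OF Lfin(2)]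
      by (simp add: bi_minimal_def)
    have mc: "m \<in> carrier G" "n \<in> carrier G" using m n by (auto simp: bi_minimal_def)
    have lc: "w\<^sub>0 L \<in> carrier G" "w\<^sub>0 L' \<in> carrier G"
      using longest_carrier[OF Lfin(1)] longest_carrier[OF Lfin(2)] by auto
    have "n = w\<^sub>0 L' \<otimes> w\<^sub>0 L \<otimes> m"
      using longest_square_left[OF Lfin(2) mc(2)] eq mc lc by (simp add: m_assoc)
    moreover have "w\<^sub>0 L' \<otimes> w\<^sub>0 L \<in> P J"
      using longest_in[OF Lfin(1)] longest_in[OF Lfin(2)] mono_generate[of L J] mono_generate[of L' J]
      by (auto simp: L_def L'_def intro!: generate.eng)
    ultimately have "n = m"
      using left_min_unique[OF Jsub mc(1), of "w\<^sub>0 L' \<otimes> w\<^sub>0 L"] m n by (simp add: bi_minimal_def)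
    moreover have "w\<^sub>0 L = w\<^sub>0 L'" using eq mc lc \<open>n = m\<close> by simp
    then have "L = L'" using longest_left_descents Lfin by metis
    ultimately show "m = n \<and> L = L'" by simp
  qed
  then show ?thesis
    by (simp add: left_redundancy_def L_def L'_def flip: m_def n_def)
qed

section \<open>Walks that record what is missing to the longest element\<close>

text \<open>
  A walk on pairs \<open>(I, z)\<close> along a list of subsets, recording only the last value of \<open>z\<close>.
\<close>

fun reduced_walk where
  "reduced_walk I z [] z' \<longleftrightarrow> z' = z"
| "reduced_walk I z (I' # Is) z' \<longleftrightarrow>
    (\<exists>s \<in> S. s \<notin> I \<and> I' = insert s I \<and> s \<in> LD z \<and> reduced_walk I' z Is z') \<or>
    (\<exists>s \<in> I. I' = I - {s} \<and> reduced_walk I' (w\<^sub>0 I' \<otimes> (w\<^sub>0 I \<otimes> z)) Is z')"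

lemma reduced_walk_append:
  "reduced_walk I z (Is @ Ks) z' \<longleftrightarrow>
    (\<exists>z1. reduced_walk I z Is z1 \<and> reduced_walk (last (I # Is)) z1 Ks z')"
  by (induction Is arbitrary: I z) (simp, fastforce)

lemma reduced_walk_deterministic:
  "reduced_walk I z Is z1 \<Longrightarrow> reduced_walk I z Is z2 \<Longrightarrow> z1 = z2"
proof (induction Is arbitrary: I z)
  case (Cons I' Is)
  show ?case
  proof (cases "I \<subseteq> I'")
    case True
    then show ?thesis using Cons.prems Cons.IH[of I' z] by auto
  next
    case False
    then show ?thesis using Cons.prems Cons.IH[of I'] by auto
  qed
qed simp

end

locale finite_coxeter_system = coxeter_system +
  assumes finite_carrier: "finite (carrier G)"
begin

lemma finitaryI [simp, intro]: "I \<subseteq> S \<Longrightarrow> finitary G S I"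
  unfolding finitary_def using finite_subset[OF _ finite_carrier] parabolic_carrier[of I] by blast

lemma parabolic_S [simp]: "P S = carrier G"
  by (rule generates)

lemma longest_closed [simp, intro]: "I \<subseteq> S \<Longrightarrow> w\<^sub>0 I \<in> carrier G"
  by (rule longest_carrier[OF finitaryI])

abbreviation remainder where "remainder I x \<equiv> w\<^sub>0 I \<otimes> inv x \<otimes> w\<^sub>0 S"

lemma left_descents_complement:
  assumes v: "v \<in> carrier G" shows "LD (v \<otimes> w\<^sub>0 S) = S - LD v"
proof -
  have "s \<in> LD (v \<otimes> w\<^sub>0 S) \<longleftrightarrow> s \<notin> LD v" if s: "s \<in> S" for s
  proof -
    have "\<ell> (u \<otimes> w\<^sub>0 S) + \<ell> u = \<ell> (w\<^sub>0 S)" if "u \<in> carrier G" for u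
      using len_mult_longest[of S u] that by simp
    from this[of v] this[of "s \<otimes> v"] show ?thesis
      using s v len_step[OF s v] by (auto simp: left_descents_def m_assoc)
  qed
  then show ?thesis using left_descents_subset by blast
qed

lemma remainder_left_descents:
  assumes I: "I \<subseteq> S" and x: "x \<in> carrier G"
  shows "LD (remainder I x) = S - RD (x \<otimes> w\<^sub>0 I)"
  using left_descents_complement[of "w\<^sub>0 I \<otimes> inv x"] left_descents_inv[of "x \<otimes> w\<^sub>0 I"] assms
    longest_inv[OF finitaryI[OF I]] by (simp add: inv_mult_group)

text \<open>
  Multiplication by \<open>w\<^sub>S\<close> complements descents, and \<open>x w\<^sub>J\<close> has no right descents in \<open>J\<close>.
\<close>

lemma subset_remainder_left_descents:
  assumes J: "J \<subseteq> S" and x: "bi_maximal I J x"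
  shows "J \<subseteq> LD (remainder J x)"
  using remainder_left_descents[OF J, of x] longest_right_max_to_min[OF finitaryI[OF J], of x] x J
  by (auto simp: bi_maximal_def)

lemma bi_maximal_longest: "J \<subseteq> S \<Longrightarrow> K \<subseteq> S \<Longrightarrow> bi_maximal J K (w\<^sub>0 S)"
  using longest_left_descents[of S] longest_right_descents[of S] by (auto simp: bi_maximal_def)

lemma remainder_growth:
  assumes I: "I \<subseteq> S" and K: "K \<subseteq> S" and x: "x \<in> carrier G"
  shows "remainder K (x \<otimes> w\<^sub>0 I \<otimes> w\<^sub>0 K) = remainder I x"
  using assms longest_inv[OF finitaryI[OF I]] longest_inv[OF finitaryI[OF K]]
    longest_square_left[OF finitaryI[OF K]]
  by (simp add: inv_mult_group m_assoc)

lemma remainder_shrink: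
  assumes I: "I \<subseteq> S" and K: "K \<subseteq> S" and x: "x \<in> carrier G"
  shows "remainder K x = w\<^sub>0 K \<otimes> (w\<^sub>0 I \<otimes> remainder I x)"
  using assms longest_square_left[OF finitaryI[OF I]] by (simp add: m_assoc)

lemma double_cosets_props:
  assumes J: "J \<subseteq> S" and K: "K \<subseteq> S" and p: "p \<in> double_cosets G J K"
  shows "y \<in> p \<Longrightarrow> p = DC J K y" "y \<in> p \<Longrightarrow> y \<in> carrier G"
    "coset_max G S p \<in> p" "bi_maximal J K (coset_max G S p)"
proof -
  obtain x where x: "x \<in> carrier G" "p = DC J K x" using p by (auto simp: double_cosets_def)
  show "y \<in> p \<Longrightarrow> p = DC J K y" using double_coset_eq[OF J K x(1)] x(2) by simp
  show "y \<in> p \<Longrightarrow> y \<in> carrier G" using double_coset_carrier[OF J K x(1)] x(2) by blast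
  show "coset_max G S p \<in> p" "bi_maximal J K (coset_max G S p)"
    using coset_max_props[OF finitaryI[OF J] finitaryI[OF K] x(1)] x(2) by auto
qed

lemma reduced_expression_for_double_coset:
  "reduced_expression_for G S Is J I p \<Longrightarrow> p \<in> double_cosets G J I \<and> J \<subseteq> S \<and> I \<subseteq> S"
proof (induction Is arbitrary: I p rule: rev_induct)
  case Nil
  then show ?case by (simp add: reduced_expression_for_iff_path)
next
  case (snoc I' Is)
  then show ?case
    by (cases "Is = []")
      (auto simp: reduced_expression_for_singleton reduced_expression_for_snoc finitary_def)
qed

text \<open>
  Reduced growth leaves \<open>x w\<^sub>I\<close>, hence the remainder, unchanged; the added generator is no right
  descent of \<open>x w\<^sub>I\<close>, which means that it is a left descent of the remainder.
\<close>

lemma reduced_walk_of_expression: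
  assumes "reduced_expression_for G S (I0 # Is) I0 J p"
  shows "reduced_walk I0 (w\<^sub>0 S) Is (remainder J (coset_max G S p))"
  using assms
proof (induction Is arbitrary: J p rule: rev_induct)
  case Nil
  then have I0: "J = I0" "I0 \<subseteq> S" "p \<in> double_cosets G I0 I0" "\<one> \<in> p"
    by (auto simp: reduced_expression_for_singleton finitary_def)
  have fin: "finitary G S I0" using I0 by blast
  have p: "p = DC I0 I0 \<one>" using double_cosets_props(1)[OF I0(2,2,3,4)] .
  have "w\<^sub>0 I0 \<in> DC I0 I0 \<one>"
    using double_coset_left[OF I0(2,2) one_closed double_coset_refl[OF one_closed] longest_in[OF fin]]
      I0 by simp
  then have "coset_max G S p = w\<^sub>0 I0"
    unfolding p using coset_max_eq[OF fin fin one_closed, of "w\<^sub>0 I0"] longest_left_descents[OF fin]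
      longest_right_descents[OF fin] I0 by (simp add: bi_maximal_def)
  then show ?case using I0 longest_square[OF fin] longest_inv[OF fin] by simp
next
  case (snoc I Is)
  let ?I1 = "last (I0 # Is)"
  obtain p' where J: "J = I" "I \<subseteq> S" and p: "p \<in> double_cosets G I0 I"
    and p': "reduced_expression_for G S (I0 # Is) I0 ?I1 p'" and step: "reduced_step G S I0 ?I1 I p' p"
    using snoc.prems reduced_expression_for_snoc[of "I0 # Is" G S I] by (auto simp: finitary_def)
  define x where "x = coset_max G S p'"
  have I01: "p' \<in> double_cosets G I0 ?I1" "I0 \<subseteq> S" "?I1 \<subseteq> S"
    using reduced_expression_for_double_coset[OF p'] by auto
  note x = double_cosets_props(3,4)[OF I01(2,3,1), folded x_def]
  have xc: "x \<in> carrier G" using x by (simp add: bi_maximal_def)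
  have p'x: "p' = DC I0 ?I1 x" using double_cosets_props(1)[OF I01(2,3,1) x(1)] .
  have IH: "reduced_walk I0 (w\<^sub>0 S) Is (remainder ?I1 x)" using snoc.IH[OF p'] by (simp add: x_def)
  have fins: "finitary G S I0" "finitary G S I" "finitary G S ?I1" using I01 J by auto
  consider s where "s \<in> S" "s \<notin> ?I1" "I = insert s ?I1" | s where "s \<in> ?I1" "I = ?I1 - {s}"
    using step unfolding reduced_step_def by blast
  then show ?case
  proof cases
    case 1
    then have psub: "p' \<subseteq> p" and red: "coset_min G S p' = coset_min G S p \<and>
        left_redundancy G S I0 ?I1 p' = left_redundancy G S I0 I p"
      using step unfolding reduced_step_def by auto
    have px: "p = DC I0 I x" using double_cosets_props(1)[OF I01(2) J(2) p] psub x by blast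
    have sub: "?I1 \<subseteq> I" using 1 by blast
    have min: "I \<inter> RD (x \<otimes> w\<^sub>0 ?I1) = {}"
      using reduced_growth_iff[OF fins(1,2) sub x(2)] red unfolding px p'x by simp
    have "w\<^sub>0 ?I1 \<otimes> w\<^sub>0 I \<in> P I"
      using longest_in[OF fins(2)] longest_in[OF fins(3)] mono_generate[OF sub] by (auto intro: generate.eng)
    then have "x \<otimes> w\<^sub>0 ?I1 \<otimes> w\<^sub>0 I \<in> DC I0 I x"
      using double_coset_right[OF I01(2) J(2) xc double_coset_refl[OF xc]] xc J I01(3)
      by (simp add: m_assoc)
    then have "coset_max G S p = x \<otimes> w\<^sub>0 ?I1 \<otimes> w\<^sub>0 I"
      unfolding px using coset_max_eq[OF fins(1,2) xc _ growth_bi_maximal[OF fins(2) sub x(2) min]] by blast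
    then have "remainder J (coset_max G S p) = remainder ?I1 x"
      using remainder_growth[OF I01(3) J(2) xc] J by simp
    moreover have "s \<in> LD (remainder ?I1 x)"
      using remainder_left_descents[OF I01(3) xc] min 1 by auto
    ultimately show ?thesis
      using IH 1 by (auto simp: reduced_walk_append intro!: exI[of _ "remainder ?I1 x"])
  next
    case 2
    then have "x \<in> p" using step by (auto simp: reduced_step_def x_def)
    then have px: "p = DC I0 I x" using double_cosets_props(1)[OF I01(2) J(2) p] by blast
    have "bi_maximal I0 I x" using x 2 by (auto simp: bi_maximal_def)
    then have "coset_max G S p = x"
      unfolding px using coset_max_eq[OF fins(1,2) xc double_coset_refl[OF xc]] by blast
    then have "remainder J (coset_max G S p) = w\<^sub>0 I \<otimes> (w\<^sub>0 ?I1 \<otimes> remainder ?I1 x)"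
      using remainder_shrink[OF I01(3) J(2) xc] J by simp
    then show ?thesis
      using IH 2 by (auto simp: reduced_walk_append intro!: exI[of _ "remainder ?I1 x"])
  qed
qed

text \<open>
  The coset reached is rebuilt step by step. The remainder determines its maximal element, so the
  condition for a growing step of the walk is the one in \<open>reduced_growth_iff\<close>.
\<close>

lemma expression_of_reduced_walk:
  assumes "reduced_walk I0 (w\<^sub>0 S) Is z" and I0: "I0 \<subseteq> S"
  shows "\<exists>p. reduced_expression_for G S (I0 # Is) I0 (last (I0 # Is)) p"
  using assms(1)
proof (induction Is arbitrary: z rule: rev_induct)
  case Nil
  have "DC I0 I0 \<one> \<in> double_cosets G I0 I0" by (auto simp: double_cosets_def)
  then show ?case using I0 double_coset_refl[OF one_closed]
    by (auto simp: reduced_expression_for_singleton)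
next
  case (snoc I Is)
  let ?I1 = "last (I0 # Is)"
  obtain z1 where z1: "reduced_walk I0 (w\<^sub>0 S) Is z1" "reduced_walk ?I1 z1 [I] z"
    using snoc.prems unfolding reduced_walk_append by blast
  obtain p' where p': "reduced_expression_for G S (I0 # Is) I0 ?I1 p'" using snoc.IH[OF z1(1)] by blast
  define x where "x = coset_max G S p'"
  have z1x: "z1 = remainder ?I1 x"
    using reduced_walk_deterministic[OF z1(1) reduced_walk_of_expression[OF p']] by (simp add: x_def)
  have I01: "p' \<in> double_cosets G I0 ?I1" "I0 \<subseteq> S" "?I1 \<subseteq> S"
    using reduced_expression_for_double_coset[OF p'] by auto
  note x = double_cosets_props(3,4)[OF I01(2,3,1), folded x_def]
  have xc: "x \<in> carrier G" using x by (simp add: bi_maximal_def)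
  have p'x: "p' = DC I0 ?I1 x" using double_cosets_props(1)[OF I01(2,3,1) x(1)] .
  have "I \<subseteq> S \<and> reduced_step G S I0 ?I1 I p' (DC I0 I x)"
  proof -
    consider s where "s \<in> S" "s \<notin> ?I1" "I = insert s ?I1" "s \<in> LD z1"
      | s where "s \<in> ?I1" "I = ?I1 - {s}"
      using z1(2) by auto
    then show ?thesis
    proof cases
      case 1
      then have I: "I \<subseteq> S" and sub: "?I1 \<subseteq> I" using I01 by auto
      have "I \<inter> RD (x \<otimes> w\<^sub>0 ?I1) = {}"
        using longest_right_max_to_min[OF finitaryI[OF I01(3)] xc] x(2) 1
          remainder_left_descents[OF I01(3) xc] z1x by (auto simp: bi_maximal_def)
      then have "coset_min G S p' = coset_min G S (DC I0 I x) \<and>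
          left_redundancy G S I0 ?I1 p' = left_redundancy G S I0 I (DC I0 I x)"
        using reduced_growth_iff[OF finitaryI[OF I01(2)] finitaryI[OF I] sub x(2)] p'x by simp
      then show ?thesis
        using 1 I double_coset_mono[OF sub] unfolding reduced_step_def p'x by blast
    next
      case 2
      then show ?thesis
        using I01(3) double_coset_refl[OF xc] unfolding reduced_step_def by (auto simp flip: x_def)
    qed
  qed
  moreover have "DC I0 I x \<in> double_cosets G I0 I" using xc by (auto simp: double_cosets_def)
  ultimately have "reduced_expression_for G S ((I0 # Is) @ [I]) I0 I (DC I0 I x)"
    using p' by (subst reduced_expression_for_snoc) auto
  then show ?case by auto
qed

text \<open>
  A shrinking step multiplies \<open>z\<close> by some \<open>u \<in> W\<^sub>I\<close>, and \<open>I \<subseteq> LD z\<close> makes the lengths in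
  \<open>z = u\<^sup>-\<^sup>1 \<cdot> u z\<close> add up, so right descents of \<open>u z\<close> are right descents of \<open>z\<close>. The inclusion
  \<open>I \<subseteq> LD z\<close> persists along the walk.
\<close>

lemma reduced_walk_descents:
  assumes "reduced_walk I z Is z'" "I \<subseteq> S" "z \<in> carrier G" "I \<subseteq> LD z"
  shows "RD z' \<subseteq> RD z"
  using assms
proof (induction Is arbitrary: I z)
  case (Cons I' Is)
  from Cons.prems(1) consider s where "s \<in> S" "I' = insert s I" "s \<in> LD z" "reduced_walk I' z Is z'"
    | s where "s \<in> I" "I' = I - {s}" "reduced_walk I' (w\<^sub>0 I' \<otimes> (w\<^sub>0 I \<otimes> z)) Is z'"
    by auto
  then show ?case
  proof cases
    case 1
    then show ?thesis using Cons.IH[of I' z] Cons.prems by auto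
  next
    case 2
    have I: "I \<subseteq> S" "I' \<subseteq> S" "I' \<subseteq> I" and z: "z \<in> carrier G" using Cons.prems 2 by auto
    have fins: "finitary G S I" "finitary G S I'" using I by auto
    let ?u = "w\<^sub>0 I' \<otimes> w\<^sub>0 I"
    have uc: "?u \<in> carrier G" using I by auto
    have u: "?u \<in> P I"
      using longest_in[OF fins(1)] longest_in[OF fins(2)] mono_generate[OF I(3)] by (auto intro: generate.eng)
    have z': "w\<^sub>0 I' \<otimes> (w\<^sub>0 I \<otimes> z) = ?u \<otimes> z" using I z by (simp add: m_assoc)
    have "\<ell> z = \<ell> (inv ?u) + \<ell> (?u \<otimes> z)"
      using len_left_max[OF I(1) z Cons.prems(4) u] uc by simp
    then have "RD (?u \<otimes> z) \<subseteq> RD z"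
      using right_descents_mult[of "inv ?u" "?u \<otimes> z"] uc z by simp
    moreover have "I' \<subseteq> LD (?u \<otimes> z)"
      using longest_left_min_to_max[OF fins(2), of "w\<^sub>0 I \<otimes> z"]
        longest_left_max_to_min[OF fins(1) z Cons.prems(4)] I z z' by auto
    ultimately show ?thesis
      using Cons.IH[of I' "?u \<otimes> z"] 2(3) z' I uc z by auto
  qed
qed simp

definition reaches where
  "reaches I z K z' \<longleftrightarrow> (\<exists>Is. last (I # Is) = K \<and> reduced_walk I z Is z')"

lemma reaches_refl: "reaches I z I z"
  unfolding reaches_def by (intro exI[of _ "[]"]) simp

lemma reaches_trans: "reaches I z K z1 \<Longrightarrow> reaches K z1 M z2 \<Longrightarrow> reaches I z M z2"
proof -
  assume "reaches I z K z1" "reaches K z1 M z2"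
  then obtain Is Ks where "last (I # Is) = K" "reduced_walk I z Is z1"
    "last (K # Ks) = M" "reduced_walk K z1 Ks z2" unfolding reaches_def by blast
  then have "reduced_walk I z (Is @ Ks) z2 \<and> last (I # Is @ Ks) = M"
    unfolding reduced_walk_append by (cases Ks) auto
  then show ?thesis unfolding reaches_def by blast
qed

lemma finite_S: "I \<subseteq> S \<Longrightarrow> finite I"
  using finite_subset[OF _ finite_carrier, of I] by auto

lemma reaches_grow:
  assumes "K \<subseteq> LD z" "I \<subseteq> K"
  shows "reaches I z K z"
proof -
  have "reaches I z (I \<union> D) z" if "finite D" "D \<subseteq> K" for D
    using that
  proof (induction D rule: finite_induct)
    case empty
    show ?case using reaches_refl by simp
  next
    case (insert s D)
    have "reaches (I \<union> D) z (insert s (I \<union> D)) z"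
    proof (cases "s \<in> I")
      case True
      then show ?thesis using reaches_refl[of "I \<union> D"] by (simp add: insert_absorb)
    next
      case False
      then have "s \<notin> I \<union> D" "s \<in> LD z" "s \<in> S" using insert assms left_descents_subset[of z] by auto
      then have "reduced_walk (I \<union> D) z [insert s (I \<union> D)] z"
        unfolding reduced_walk.simps by blast
      then show ?thesis unfolding reaches_def by (intro exI[of _ "[insert s (I \<union> D)]"]) simp
    qed
    then show ?case using insert reaches_trans by auto
  qed
  from this[of K] show ?thesis
    using assms left_descents_subset[of z] finite_S[of K] by (auto simp: Un_absorb1)
qed

lemma reaches_shrink:
  assumes I: "I \<subseteq> S" and K: "K \<subseteq> I" and z: "z \<in> carrier G"
  shows "reaches I z K (w\<^sub>0 K \<otimes> (w\<^sub>0 I \<otimes> z))"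
proof -
  have "reaches I z (I - D) (w\<^sub>0 (I - D) \<otimes> (w\<^sub>0 I \<otimes> z))" if "finite D" "D \<subseteq> I" for D
    using that
  proof (induction D rule: finite_induct)
    case empty
    show ?case using reaches_refl[of I z] longest_square_left[OF finitaryI[OF I] z] by simp
  next
    case (insert s D)
    let ?z = "w\<^sub>0 (I - D) \<otimes> (w\<^sub>0 I \<otimes> z)"
    have fin: "finitary G S (I - D)" using I by auto
    have eq: "I - insert s D = (I - D) - {s}" by auto
    have "reaches (I - D) ?z (I - D - {s}) (w\<^sub>0 (I - D - {s}) \<otimes> (w\<^sub>0 (I - D) \<otimes> ?z))"
      unfolding reaches_def using insert by (intro exI[of _ "[I - D - {s}]"]) auto
    then show ?case
      unfolding eq using insert reaches_trans longest_square_left[OF fin, of "w\<^sub>0 I \<otimes> z"] I z by auto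
  qed
  from this[of "I - K"] show ?thesis
    using K finite_S[of "I - K"] I double_diff[OF K subset_refl] by auto
qed

text \<open>
  Induction on the length of the minimal element \<open>m\<close>. Shrinking \<open>J\<close> to the redundancy turns \<open>z\<close> into
  \<open>m w\<^sub>K\<close>, and then a left descent \<open>t\<close> of \<open>m\<close> may be added, which enlarges the double coset to one that
  contains \<open>t m\<close>.
\<close>

lemma reaches_longest_of_bi_maximal:
  assumes K: "K \<subseteq> S" and "J \<subseteq> S" "bi_minimal J K m" "bi_maximal J K z" "z \<in> DC J K m"
  shows "reaches J z K (w\<^sub>0 K)"
  using assms(2-)
proof (induction "\<ell> m" arbitrary: J m z rule: less_induct)
  case less
  let ?L = "redundancy J K m" and ?g = "m \<otimes> w\<^sub>0 K"
  have J: "J \<subseteq> S" and m: "m \<in> carrier G" "K \<inter> RD m = {}"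
    using less.prems by (auto simp: bi_minimal_def)
  have fins: "finitary G S J" "finitary G S K" using J K by auto
  have L: "?L \<subseteq> J" "?L \<subseteq> S" using J by auto
  have gc: "?g \<in> carrier G" using m K by auto
  have zc: "z \<in> carrier G" using less.prems by (simp add: bi_maximal_def)
  have z: "z = w\<^sub>0 J \<otimes> (w\<^sub>0 ?L \<otimes> ?g)"
    using bi_maximal_eq[OF fins less.prems(2,3,4)] .
  have "w\<^sub>0 ?L \<otimes> (w\<^sub>0 J \<otimes> z) = ?g"
    unfolding z using longest_square_left[OF fins(1)] longest_square_left[OF finitaryI[OF L(2)]]
      gc longest_closed[OF L(2)] by (metis m_closed)
  then have shrink: "reaches J z ?L ?g" using reaches_shrink[OF J L(1) zc] by simp
  show ?case
  proof (cases "m = \<one>")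
    case True
    then have "?L \<subseteq> K" "?g = w\<^sub>0 K" using K by auto
    then have "reaches ?L ?g K (w\<^sub>0 K)"
      using reaches_grow[of K "w\<^sub>0 K" ?L] longest_left_descents[OF fins(2)] by simp
    then show ?thesis using reaches_trans[OF shrink] by blast
  next
    case False
    then obtain t where t: "t \<in> S" "t \<in> LD m"
      using parabolic_left_descent[of S m] m by auto
    let ?M = "insert t ?L"
    have M: "?M \<subseteq> S" using t L by auto
    have "LD m \<subseteq> LD ?g"
      using left_descents_mult[OF m(1) longest_closed[OF K]]
        len_right_min[OF K m longest_in[OF fins(2)]] by simp
    then have Mg: "?M \<subseteq> LD ?g"
      using t redundancy_left_descents[OF fins less.prems(2)] by auto
    have grow: "reaches ?L ?g ?M ?g" using reaches_grow[OF Mg] by auto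
    obtain n where n: "n \<in> DC ?M K ?g" "bi_minimal ?M K n" "\<And>y. y \<in> DC ?M K ?g \<Longrightarrow> \<ell> n \<le> \<ell> y"
      using bi_minimal_exists[OF M K gc] by blast
    have "m = ?g \<otimes> w\<^sub>0 K" using m K longest_square[OF fins(2)] by (simp add: m_assoc)
    then have "m \<in> DC ?M K ?g"
      using double_coset_right[OF M K gc double_coset_refl[OF gc] longest_in[OF fins(2)]] by simp
    then have "t \<otimes> m \<in> DC ?M K ?g"
      using double_coset_left[OF M K gc, of m t] by (simp add: generate.incl)
    then have "\<ell> n < \<ell> m" using n(3) t by (fastforce simp: left_descents_def)
    moreover have "bi_maximal ?M K ?g"
      using Mg longest_right_min_to_max[OF fins(2) m] gc by (simp add: bi_maximal_def)
    ultimately have "reaches ?M ?g K (w\<^sub>0 K)"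
      using less.hyps[OF _ M n(2)] double_coset_sym[OF M K gc n(1)] by blast
    then show ?thesis using reaches_trans[OF shrink] reaches_trans[OF grow] by blast
  qed
qed

lemma reaches_longest_iff:
  assumes J: "J \<subseteq> S" and K: "K \<subseteq> S" and z: "z \<in> carrier G" "J \<subseteq> LD z"
  shows "reaches J z K (w\<^sub>0 K) \<longleftrightarrow> K \<subseteq> RD z"
proof
  assume "reaches J z K (w\<^sub>0 K)"
  then show "K \<subseteq> RD z"
    using reduced_walk_descents[OF _ J z] longest_right_descents[OF finitaryI[OF K]]
    unfolding reaches_def by blast
next
  assume "K \<subseteq> RD z"
  then have "bi_maximal J K z" using z by (simp add: bi_maximal_def)
  moreover obtain m where "m \<in> DC J K z" "bi_minimal J K m"
    using bi_minimal_exists[OF J K z(1)] by blast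
  ultimately show "reaches J z K (w\<^sub>0 K)"
    using reaches_longest_of_bi_maximal[OF K J] double_coset_sym[OF J K z(1)] by blast
qed

lemma singular_expression_of_walk:
  assumes "reduced_walk I z Is z'" "I \<subseteq> S"
  shows "singular_expression G S (I # Is)"
  using assms
proof (induction Is arbitrary: I z)
  case Nil
  then show ?case by (simp add: singular_expression_def)
next
  case (Cons I' Is)
  have "I' \<subseteq> S" using Cons.prems by auto
  then have tail: "singular_expression G S (I' # Is)" using Cons by auto
  have first: "\<exists>s \<in> S. s \<notin> I \<and> I' = insert s I \<or> s \<in> I \<and> I' = I - {s}"
    using Cons.prems by auto
  show ?case unfolding singular_expression_def
  proof (intro conjI allI impI)
    fix i assume "Suc i < length (I # I' # Is)"
    then show "\<exists>s \<in> S. s \<notin> (I # I' # Is) ! i \<and> (I # I' # Is) ! Suc i = insert s ((I # I' # Is) ! i) \<or>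
        s \<in> (I # I' # Is) ! i \<and> (I # I' # Is) ! Suc i = (I # I' # Is) ! i - {s}"
      using first tail by (cases i) (auto simp: singular_expression_def)
  qed (use tail Cons.prems in \<open>auto simp: singular_expression_def\<close>)
qed

text \<open>
  The double coset of \<open>w\<^sub>S\<close> has maximal element \<open>w\<^sub>S\<close> and hence remainder \<open>w\<^sub>K\<close>. Conversely, the
  remainder \<open>w\<^sub>K\<close> forces the maximal element to be \<open>w\<^sub>S\<close>. So completions are walks from the
  remainder of \<open>p\<close> to \<open>w\<^sub>K\<close>.
\<close>

lemma completion_iff:
  assumes red: "reduced_expression_for G S Is I0 J p" and K: "K \<subseteq> S"
  shows "(\<exists>Ks. singular_expression G S Ks \<and> hd Ks = J \<and> last Ks = K \<and>
      reduced_expression_for G S (concat_expressions Is Ks) I0 K (DC I0 K (w\<^sub>0 S))) \<longleftrightarrow>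
    K \<subseteq> RD (remainder J (coset_max G S p))" (is "?lhs \<longleftrightarrow> K \<subseteq> RD ?z")
proof -
  obtain Is' where Is: "Is = I0 # Is'" "last Is = J"
    using red by (cases Is) (auto simp: reduced_expression_for_iff_path)
  have J: "p \<in> double_cosets G I0 J" "I0 \<subseteq> S" "J \<subseteq> S"
    using reduced_expression_for_double_coset[OF red] by auto
  note x = double_cosets_props(3,4)[OF J(2,3,1)]
  have xc: "coset_max G S p \<in> carrier G" using x by (simp add: bi_maximal_def)
  have zc: "?z \<in> carrier G" using xc J by simp
  have zJ: "J \<subseteq> LD ?z" using subset_remainder_left_descents[OF J(3) x(2)] .
  have walk: "reduced_walk I0 (w\<^sub>0 S) Is' ?z" using reduced_walk_of_expression red Is(1) by blast
  have wS: "w\<^sub>0 S \<in> carrier G" by auto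
  have max_q: "coset_max G S (DC I0 K (w\<^sub>0 S)) = w\<^sub>0 S"
    using coset_max_eq[OF _ _ wS double_coset_refl[OF wS] bi_maximal_longest] J K by blast
  have "?lhs \<longleftrightarrow> reaches J ?z K (w\<^sub>0 K)"
  proof
    assume ?lhs
    then obtain Ks where Ks: "singular_expression G S Ks" "hd Ks = J" "last Ks = K"
      "reduced_expression_for G S (Is @ tl Ks) I0 K (DC I0 K (w\<^sub>0 S))"
      by (auto simp: concat_expressions_def)
    have KsJ: "Ks = J # tl Ks" using Ks by (cases Ks) (auto simp: singular_expression_def)
    have "reduced_walk I0 (w\<^sub>0 S) (Is' @ tl Ks) (remainder K (w\<^sub>0 S))"
      using reduced_walk_of_expression[of I0 "Is' @ tl Ks" K "DC I0 K (w\<^sub>0 S)"] Ks(4) Is(1)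
      unfolding max_q by simp
    then have "reduced_walk I0 (w\<^sub>0 S) (Is' @ tl Ks) (w\<^sub>0 K)"
      using K wS longest_square[of S] by (simp add: m_assoc)
    then have "reduced_walk J ?z (tl Ks) (w\<^sub>0 K)"
      using reduced_walk_deterministic[OF walk] Is by (auto simp: reduced_walk_append)
    then show "reaches J ?z K (w\<^sub>0 K)" unfolding reaches_def using KsJ Ks(3) by metis
  next
    assume "reaches J ?z K (w\<^sub>0 K)"
    then obtain Ks where Ks: "last (J # Ks) = K" "reduced_walk J ?z Ks (w\<^sub>0 K)"
      unfolding reaches_def by blast
    have full: "reduced_walk I0 (w\<^sub>0 S) (Is' @ Ks) (w\<^sub>0 K)"
      using walk Ks(2) Is by (auto simp: reduced_walk_append)
    have last: "last (I0 # Is' @ Ks) = K" using Ks(1) Is by (cases Ks) auto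
    obtain q where q: "reduced_expression_for G S (I0 # Is' @ Ks) I0 K q"
      using expression_of_reduced_walk[OF full J(2)] last by auto
    have qd: "q \<in> double_cosets G I0 K" using reduced_expression_for_double_coset[OF q] by blast
    note y = double_cosets_props(3,4)[OF J(2) K qd]
    have yc: "coset_max G S q \<in> carrier G" using y by (simp add: bi_maximal_def)
    have "remainder K (coset_max G S q) = w\<^sub>0 K"
      using reduced_walk_deterministic[OF reduced_walk_of_expression[OF q] full] .
    then have "w\<^sub>0 K \<otimes> (inv (coset_max G S q) \<otimes> w\<^sub>0 S) = w\<^sub>0 K \<otimes> \<one>"
      using yc K wS by (simp add: m_assoc)
    then have "inv (coset_max G S q) \<otimes> w\<^sub>0 S = \<one>" using yc K wS by simp
    then have "coset_max G S q = w\<^sub>0 S" using yc wS by (metis inv_mult_cancel_left(2) r_one)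
    then have "q = DC I0 K (w\<^sub>0 S)" using double_cosets_props(1)[OF J(2) K qd y(1)] by simp
    then show ?lhs using q Ks(1) Is singular_expression_of_walk[OF Ks(2) J(3)]
      by (intro exI[of _ "J # Ks"]) (simp add: concat_expressions_def)
  qed
  then show ?thesis using reaches_longest_iff[OF J(3) K zc zJ] by simp
qed

end

theorem proposition4p4:
  fixes W :: "('a, 'b) monoid_scheme" (structure)
    and S :: "'a set" and Is :: "'a set list" and I0 J p :: "'a set"
  assumes "coxeter_system W S"
    and "finite (carrier W)"
    and "reduced_expression_for W S Is I0 J p"
  shows "(\<exists>Ks. singular_expression W S Ks \<and> hd Ks = J \<and>
           reduced_expression_for W S (concat_expressions Is Ks) I0 (last Ks)
             (double_coset W I0 (last Ks) (longest W S S))) \<and>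
         (\<forall>K' \<subseteq> S.
           (\<exists>Ks. singular_expression W S Ks \<and> hd Ks = J \<and> last Ks = K' \<and>
             reduced_expression_for W S (concat_expressions Is Ks) I0 K'
               (double_coset W I0 K' (longest W S S))) \<longleftrightarrow>
           K' \<subseteq> right_descents W S (longest W S J \<otimes> inv (coset_max W S p) \<otimes> longest W S S))"
proof -
  interpret finite_coxeter_system W S
    using assms(1,2) by (simp add: finite_coxeter_system_def finite_coxeter_system_axioms_def)
  show ?thesis
  proof (intro conjI allI impI)
    \<comment> \<open>The empty set satisfies the criterion for every remainder.\<close>
    obtain Ks where "singular_expression W S Ks" "hd Ks = J" "last Ks = {}"
      "reduced_expression_for W S (concat_expressions Is Ks) I0 {} (double_coset W I0 {} (longest W S S))"
      using completion_iff[OF assms(3), of "{}"] by auto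
    then show "\<exists>Ks. singular_expression W S Ks \<and> hd Ks = J \<and>
        reduced_expression_for W S (concat_expressions Is Ks) I0 (last Ks)
          (double_coset W I0 (last Ks) (longest W S S))"
      by (intro exI[of _ Ks]) simp
  qed (rule completion_iff[OF assms(3)])
qed

end
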